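(* Let $k_0\in\mathbb{N}$, $0<\epsilon<\pi/2$, $U\in(0,\pi/2-\epsilon]$, $\Delta>0$, and $1\le k_3,k_4,k_5,k_6,k_7,\bar k_\Delta\le k_0$. For $L\in\mathbb{N}$ large consider on $[2\pi L,2\pi L+U]$ the functions $$f_3(t)=\sin^2t,\quad f_4(t)=\cos^2t,\quad f_5(t)=\frac1{\cos^2t},\quad f_6(t)=\cos^3t,\quad f_7(t)=\cos t,\quad \overset{*}{\bar f}_\Delta(t)=(t-2\pi L)^\Delta,$$ and write (with $T=2\pi L$) $\alpha_r^{m,k_m}=\alpha_r^{f_m,k_m}$ for $m=3,\dots,7$, $\overset{*}{\bar\alpha}{}_r^{\Delta,\bar k_\Delta}=\alpha_r^{\overset{*}{\bar f}_\Delta,\bar k_\Delta}$, $\overset{*}{\bar\beta}{}_r^{\bar k_\Delta}=\beta_r^{\bar k_\Delta}$ and $\beta_r^{k_m}$ for the associated points defined in the context. Then, as $L\to\infty$, $$\begin{aligned}\prod_{r=1}^{k_6}\left|\frac{\zeta(\frac12+i\alpha_r^{6,k_6})}{\zeta(\frac12+i\beta_r^{k_6})}\right|^2\sim{}&\frac{\cos(\alpha_0^{7,k_7})}{\cos^3(\alpha_0^{6,k_6})}\prod_{r=1}^{k_7}\left|\frac{\zeta(\frac12+i\alpha_r^{7,k_7})}{\zeta(\frac12+i\beta_r^{k_7})}\right|^2\\&-\frac{(1+\Delta)^{2/\Delta}}{3}\,\frac{(\overset{*}{\bar\alpha}{}_0^{\Delta,\bar k_\Delta}-2\pi L)^2}{\cos^3(\alpha_0^{5,k_5})\cos^3(\alpha_0^{6,k_6})}\left\{\prod_{r=1}^{\bar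 k_\Delta}\left|\frac{\zeta(\frac12+i\overset{*}{\bar\alpha}{}_r^{\Delta,\bar k_\Delta})}{\zeta(\frac12+i\overset{*}{\bar\beta}{}_r^{\bar k_\Delta})}\right|^2\right\}^{2/\Delta}\left\{\prod_{r=1}^{k_5}\left|\frac{\zeta(\frac12+i\alpha_r^{5,k_5})}{\zeta(\frac12+i\beta_r^{k_5})}\right|^2\right\}^{3/2}\\&\times\left\{\cos^2(\alpha_0^{4,k_4})\prod_{r=1}^{k_4}\left|\frac{\zeta(\frac12+i\alpha_r^{4,k_4})}{\zeta(\frac12+i\beta_r^{k_4})}\right|^2-\sin^2(\alpha_0^{3,k_3})\prod_{r=1}^{k_3}\left|\frac{\zeta(\frac12+i\alpha_r^{3,k_3})}{\zeta(\frac12+i\beta_r^{k_3})}\right|^2\right\}^{3/2}.\end{aligned}$$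
   Context: Notation. $\zeta$ is the Riemann zeta-function, $Z(t)$ is Hardy's function (so $|Z(t)|=|\zeta(\frac12+it)|$). $A\sim B$ means $A/B\to1$; in the claim $B$ is the whole right-hand side (the difference of the two terms). Jacob's ladder. Let $\mu\in C^\infty([y_0,\infty))$ be a fixed increasing unbounded function with $\mu(y)\ge 7y\ln y$. For all sufficiently large $T$ the equation $\int_0^{\mu[x(T)]}Z^2(t)e^{-2t/x(T)}\,dt=\int_0^T Z^2(t)\,dt$ has a unique solution $x(T)=\varphi(T)$. Put $\varphi_1=\frac12\varphi$ (Jacob's ladder). It is strictly increasing and unbounded, and $\tilde Z^2(t):=\varphi_1'(t)=|\zeta(\frac12+it)|^2/\omega(t)$, $\omega(t)=\{1+O(\ln\ln t/\ln t)\}\ln t$. Write $\varphi_1^0(t)=t$, $\varphi_1^{r}=\varphi_1\circ\varphi_1^{r-1}$, and for large $T$ let $\overset{r}{T}$ be defined by $\varphi_1^r(\overset{r}{T})=T$. The class $\tilde C_0[T,T+U]$, $U=o(T/\ln T)$, consists of the continuous functions $f$ on $[T,T+U]$ that do not change sign and are not identically zero. Associated points. Let $1\le k\le k_0$. For $f\in\tilde C_0[T,T+U]$ the substitution rule and the mean value theorem give a point $d\in(\overset{k}{T},\overset{k}{\overset{\frown}{T+U}})$, where $\overset{k}{\overset{\frown}{T+U}}$ denotes the point with $\varphi_1^k(\overset{k}{\overset{\frown}{T+U}})=T+U$, such that $$\int_T^{T+U}f(t)\,dt=f(\varphi_1^k(d))\prod_{r=0}^{k-1}\tilde Z^2(\varphi_1^r(d))\cdot\bigl(\overset{k}{\overset{\frown}{T+U}}-\overset{k}{T}\bigr);$$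 fix such $d=d(U,T,k;f)$ and put $\alpha_r^{f,k}=\varphi_1^{k-r}(d)$, $r=0,1,\dots,k$ (so $T<\alpha_0^{f,k}<T+U$). For $f\equiv1$ fix in the same way a point $e=e(U,T,k)$ and put $\beta_r^{k}=\varphi_1^{k-r}(e)$, $r=1,\dots,k$. *)

theory Defs
  imports "HOL-Complex_Analysis.Complex_Analysis"
begin

text \<open>
  The Riemann zeta-function, as the analytic continuation of the Dirichlet series from
  \<open>Re s > 1\<close> to \<open>Re s > 0\<close>, \<open>s \<noteq> 1\<close>. This contains the critical line, the only place where the
  function is evaluated below; elsewhere the value is unspecified. The lemmas
  \<open>zeta_holomorphic\<close> and \<open>zeta_eq_series\<close> show that the continuation exists.
\<close>

definition zeta_domain :: "complex set" where
  "zeta_domain = {s. 0 < Re s} - {1}"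

definition continues_zeta_series :: "(complex \<Rightarrow> complex) \<Rightarrow> bool" where
  "continues_zeta_series f \<longleftrightarrow>
     f holomorphic_on zeta_domain \<and>
     (\<forall>s. 1 < Re s \<longrightarrow> f s = (\<Sum>n. 1 / of_nat (Suc n) powr s))"

definition zeta :: "complex \<Rightarrow> complex" where
  "zeta s = (THE z. \<exists>f. continues_zeta_series f \<and> f s = z)"

lemma open_zeta_domain: "open zeta_domain"
  unfolding zeta_domain_def by (intro open_delete open_halfspace_Re_gt)

lemma connected_zeta_domain: "connected zeta_domain"
  unfolding zeta_domain_def
  by (intro connected_open_delete open_halfspace_Re_gt)
     (auto intro!: convex_connected convex_halfspace_Re_gt)

lemma continues_zeta_series_unique:
  assumes f: "continues_zeta_series f" and g: "continues_zeta_series g" and s: "s \<in> zeta_domain"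
  shows "f s = g s"
proof (rule analytic_continuation_open[where f = f and g = g and z = s and s' = zeta_domain])
  show "open {s. 1 < Re s}" by (rule open_halfspace_Re_gt)
  have "(2::complex) \<in> {s. 1 < Re s}" by simp
  then show "{s. 1 < Re s} \<noteq> {}" by blast
  show "{s. 1 < Re s} \<subseteq> zeta_domain" by (auto simp: zeta_domain_def)
  show "f z = g z" if "z \<in> {s. 1 < Re s}" for z
    using f g that by (simp add: continues_zeta_series_def)
qed (use f g s in \<open>simp_all add: continues_zeta_series_def open_zeta_domain connected_zeta_domain\<close>)

definition zeta_term :: "nat \<Rightarrow> complex \<Rightarrow> complex" where
  "zeta_term n s = 1 / of_nat (Suc n) powr s -
     (of_nat (Suc (Suc n)) powr (1 - s) - of_nat (Suc n) powr (1 - s)) / (1 - s)"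

lemma norm_zeta_term_le:
  assumes s: "s \<in> zeta_domain"
  shows "norm (zeta_term n s) \<le> norm s * real (Suc n) powr (- Re s - 1)"
proof -
  have s1: "s \<noteq> 1" and Re: "0 < Re s" using s by (auto simp: zeta_domain_def)
  define a :: complex where "a = of_nat (Suc n)"
  define B where "B = norm s * real (Suc n) powr (- Re s - 1)"
  have seg: "\<exists>x. y = of_real x \<and> real (Suc n) \<le> x \<and> x \<le> real (Suc n) + 1"
    if y: "y \<in> closed_segment a (a + 1)" for y
  proof -
    obtain u where u: "0 \<le> u" "u \<le> 1" "y = (1 - u) *\<^sub>R a + u *\<^sub>R (a + 1)"
      using y by (auto simp: closed_segment_def)
    have "y = of_real (real (Suc n) + u)"
      unfolding u(3) a_def by (simp add: scaleR_conv_of_real algebra_simps)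
    then show ?thesis using u by (intro exI[of _ "real (Suc n) + u"]) auto
  qed
  have nonneg: "y \<notin> \<real>\<^sub>\<le>\<^sub>0" if "y \<in> closed_segment a (a + 1)" for y
    using seg[OF that] by (auto simp: complex_nonpos_Reals_iff)
  have a_in: "a \<in> closed_segment a (a + 1)" by simp
  have pow_le: "norm (y powr (- s) - a powr (- s)) \<le> B"
    if y: "y \<in> closed_segment a (a + 1)" for y
  proof -
    have "norm (y powr (- s) - a powr (- s)) \<le> B * norm (y - a)"
    proof (rule field_differentiable_bound[of "closed_segment a (a + 1)"])
      show "((\<lambda>z. z powr (- s)) has_field_derivative (- s) * z powr (- s - 1))
              (at z within closed_segment a (a + 1))" if "z \<in> closed_segment a (a + 1)" for z
        using has_field_derivative_powr[OF nonneg[OF that], of "- s"]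
        by (rule has_field_derivative_at_within)
      show "norm ((- s) * z powr (- s - 1)) \<le> B" if z: "z \<in> closed_segment a (a + 1)" for z
      proof -
        obtain x where x: "z = of_real x" "real (Suc n) \<le> x" using seg[OF z] by auto
        have "norm (z powr (- s - 1)) = x powr (- Re s - 1)"
          using x by (simp add: norm_powr_real_powr)
        also have "\<dots> \<le> real (Suc n) powr (- Re s - 1)"
          using x Re by (intro powr_mono2') auto
        finally show ?thesis
          unfolding B_def by (simp add: norm_mult mult_left_mono)
      qed
    qed (use y a_in in auto)
    also have "norm (y - a) \<le> 1"
      using segment_bound1[OF y] by simp
    then have "B * norm (y - a) \<le> B"
      using mult_left_mono[of "norm (y - a)" 1 B] by (simp add: B_def)
    finally show ?thesis .
  qed
  define h where "h = (\<lambda>z. z powr (1 - s) / (1 - s) - a powr (- s) * z)"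
  have "norm (h (a + 1) - h a) \<le> B * norm ((a + 1) - a)"
  proof (rule field_differentiable_bound[of "closed_segment a (a + 1)"])
    show "(h has_field_derivative z powr (- s) - a powr (- s))
              (at z within closed_segment a (a + 1))" if "z \<in> closed_segment a (a + 1)" for z
    proof -
      have "((\<lambda>z. z powr (1 - s)) has_field_derivative (1 - s) * z powr (- s)) (at z)"
        using has_field_derivative_powr[OF nonneg[OF that], of "1 - s"] by simp
      then have "(h has_field_derivative ((1 - s) * z powr (- s)) / (1 - s) - a powr (- s) * 1) (at z)"
        unfolding h_def by (intro DERIV_diff DERIV_cdivide DERIV_cmult DERIV_ident)
      then show ?thesis
        using s1 by (simp add: has_field_derivative_at_within)
    qed
  qed (use pow_le in auto)
  moreover have "h (a + 1) - h a = - zeta_term n s"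
    unfolding h_def zeta_term_def a_def using s1
    by (simp add: powr_minus divide_simps) (simp add: algebra_simps)
  ultimately show ?thesis by (simp add: B_def)
qed

lemma continues_zeta_series_exists:
  "continues_zeta_series (\<lambda>s. 1 / (s - 1) + (\<Sum>n. zeta_term n s))"
  unfolding continues_zeta_series_def
proof (intro conjI allI impI)
  have "(\<lambda>s. \<Sum>n. zeta_term n s) holomorphic_on zeta_domain"
  proof (rule holomorphic_uniform_sequence[OF open_zeta_domain])
    show "(\<lambda>s. \<Sum>i<n. zeta_term i s) holomorphic_on zeta_domain" for n
      unfolding zeta_term_def
      by (intro holomorphic_intros) (auto simp: zeta_domain_def powr_def)
    fix s assume s: "s \<in> zeta_domain"
    obtain d where d: "0 < d" "cball s d \<subseteq> zeta_domain"
      using open_zeta_domain s open_contains_cball by blast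
    define e where "e = min d (Re s / 2)"
    have Re: "0 < Re s" using s by (simp add: zeta_domain_def)
    have e: "0 < e" "cball s e \<subseteq> zeta_domain"
      using d Re by (auto simp: e_def)
    have "uniform_limit (cball s e) (\<lambda>n s. \<Sum>i<n. zeta_term i s) (\<lambda>s. \<Sum>i. zeta_term i s) sequentially"
    proof (rule Weierstrass_m_test)
      show "norm (zeta_term n w) \<le> (norm s + e) * real (Suc n) powr (- (Re s / 2) - 1)"
        if w: "w \<in> cball s e" for n w
      proof -
        have dw: "norm (s - w) \<le> e" using w by (simp add: dist_norm)
        have "\<bar>Re (s - w)\<bar> \<le> norm (s - w)" by (rule abs_Re_le_cmod)
        then have Rew: "Re s / 2 \<le> Re w"
          using dw min.cobounded2[of d "Re s / 2"] unfolding e_def minus_complex.simps by linarith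
        have "norm w \<le> norm s + norm (s - w)"
          using norm_triangle_ineq4[of s "s - w"] by simp
        then have nw: "norm w \<le> norm s + e" using dw by linarith
        have "norm (zeta_term n w) \<le> norm w * real (Suc n) powr (- Re w - 1)"
          using w e(2) by (intro norm_zeta_term_le) blast
        also have "\<dots> \<le> (norm s + e) * real (Suc n) powr (- (Re s / 2) - 1)"
          using nw Rew e(1) by (intro mult_mono powr_mono) auto
        finally show ?thesis .
      qed
      have "summable (\<lambda>n. real n powr (- (Re s / 2) - 1))"
        using Re by (simp add: summable_real_powr_iff)
      then show "summable (\<lambda>n. (norm s + e) * real (Suc n) powr (- (Re s / 2) - 1))"
        by (intro summable_mult) (subst summable_Suc_iff[of "\<lambda>n. real n powr (- (Re s / 2) - 1)"])
    qed
    then show "\<exists>d>0. cball s d \<subseteq> zeta_domain \<and>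
        uniform_limit (cball s d) (\<lambda>n s. \<Sum>i<n. zeta_term i s) (\<lambda>s. \<Sum>i. zeta_term i s) sequentially"
      using e by blast
  qed
  then show "(\<lambda>s. 1 / (s - 1) + (\<Sum>n. zeta_term n s)) holomorphic_on zeta_domain"
    by (intro holomorphic_intros) (auto simp: zeta_domain_def)
next
  fix s :: complex assume s: "1 < Re s"
  then have s1: "s \<noteq> 1" by auto
  have "summable (\<lambda>n. real n powr (- Re s))"
    using s by (simp add: summable_real_powr_iff)
  then have "summable (\<lambda>n. real (Suc n) powr (- Re s))"
    by (subst summable_Suc_iff[of "\<lambda>n. real n powr (- Re s)"])
  moreover have "norm (1 / (of_nat (Suc n) :: complex) powr s) = real (Suc n) powr (- Re s)" for n
    using norm_powr_real_powr[of "of_nat (Suc n)" s]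
    by (simp add: norm_divide norm_inverse powr_minus divide_inverse)
  ultimately have "summable (\<lambda>n. norm (1 / (of_nat (Suc n) :: complex) powr s))"
    by (simp only:)
  then have sm: "summable (\<lambda>n. 1 / (of_nat (Suc n) :: complex) powr s)"
    by (rule summable_norm_cancel)
  have "filterlim (\<lambda>n. real (Suc n)) at_top sequentially"
    by (rule filterlim_compose[OF filterlim_real_sequentially filterlim_Suc])
  then have "(\<lambda>n. real (Suc n) powr (1 - Re s)) \<longlonglongrightarrow> 0"
    using s by (intro tendsto_neg_powr) auto
  moreover have "norm ((of_nat (Suc n) :: complex) powr (1 - s)) = real (Suc n) powr (1 - Re s)" for n
    using norm_powr_real_powr[of "of_nat (Suc n)" "1 - s"] by simp
  ultimately have "(\<lambda>n. norm ((of_nat (Suc n) :: complex) powr (1 - s))) \<longlonglongrightarrow> 0"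
    by (simp only:)
  then have "(\<lambda>n. (of_nat (Suc n) :: complex) powr (1 - s)) \<longlonglongrightarrow> 0"
    by (rule tendsto_norm_zero_cancel)
  then have lim: "(\<lambda>n. (of_nat (Suc n) :: complex) powr (1 - s) / (1 - s)) \<longlonglongrightarrow> 0 / (1 - s)"
    using s1 by (intro tendsto_divide tendsto_const) auto
  have "(\<lambda>n. of_nat (Suc (Suc n)) powr (1 - s) / (1 - s) - of_nat (Suc n) powr (1 - s) / (1 - s))
          sums (0 / (1 - s) - of_nat (Suc 0) powr (1 - s) / (1 - s))"
    using lim by (rule telescope_sums)
  from sums_diff[OF summable_sums[OF sm] this] have "(\<lambda>n. zeta_term n s) sums
      ((\<Sum>n. 1 / of_nat (Suc n) powr s) - (0 / (1 - s) - of_nat (Suc 0) powr (1 - s) / (1 - s)))"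
    unfolding zeta_term_def diff_divide_distrib .
  then show "1 / (s - 1) + (\<Sum>n. zeta_term n s) = (\<Sum>n. 1 / of_nat (Suc n) powr s)"
    using s1 minus_divide_right[of 1 "1 - s"] by (simp add: sums_iff)
qed

lemma zeta_eqI:
  assumes "continues_zeta_series f" "s \<in> zeta_domain"
  shows "zeta s = f s"
  unfolding zeta_def
proof (rule the_equality)
  show "\<exists>g. continues_zeta_series g \<and> g s = f s"
    using assms(1) by (intro exI[of _ f]) simp
  show "z = f s" if "\<exists>g. continues_zeta_series g \<and> g s = z" for z
  proof -
    from that obtain g where "continues_zeta_series g" "g s = z" by auto
    then show ?thesis using continues_zeta_series_unique[of g f s] assms by simp
  qed
qed

lemma zeta_holomorphic: "zeta holomorphic_on {s. 0 < Re s} - {1}"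
proof -
  let ?f = "\<lambda>s. 1 / (s - 1) + (\<Sum>n. zeta_term n s)"
  have "?f holomorphic_on zeta_domain"
    using continues_zeta_series_exists by (simp add: continues_zeta_series_def)
  then have "zeta holomorphic_on zeta_domain"
    by (rule holomorphic_transform) (rule zeta_eqI[OF continues_zeta_series_exists, symmetric])
  then show ?thesis by (simp add: zeta_domain_def)
qed

lemma zeta_eq_series:
  assumes "1 < Re s"
  shows "zeta s = (\<Sum>n. 1 / of_nat (Suc n) powr s)"
proof -
  have "s \<in> zeta_domain" using assms by (auto simp: zeta_domain_def)
  then have "zeta s = 1 / (s - 1) + (\<Sum>n. zeta_term n s)"
    by (rule zeta_eqI[OF continues_zeta_series_exists])
  also have "\<dots> = (\<Sum>n. 1 / of_nat (Suc n) powr s)"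
    using continues_zeta_series_exists assms unfolding continues_zeta_series_def by simp
  finally show ?thesis .
qed

text \<open>
  Hardy's function \<open>Z t = exp (i \<theta>(t)) \<zeta>(1/2 + i t)\<close>, with the Riemann-Siegel \<open>\<theta>\<close>. Its values are real
  (by the functional equation); here it has type \<open>complex\<close>, and \<open>Z\<^sup>2\<close> is written as \<open>(cmod Z)\<^sup>2\<close>.
\<close>

definition hardy_theta :: "real \<Rightarrow> real" where
  "hardy_theta t = Im (ln_Gamma (Complex (1/4) (t/2))) - t / 2 * ln pi"

definition hardy_Z :: "real \<Rightarrow> complex" where
  "hardy_Z t = cis (hardy_theta t) * zeta (Complex (1/2) t)"

definition smooth_from :: "real \<Rightarrow> (real \<Rightarrow> real) \<Rightarrow> bool" where
  "smooth_from a f \<longleftrightarrow> (\<exists>D :: nat \<Rightarrow> real \<Rightarrow> real. D 0 = f \<and>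
     (\<forall>n. \<forall>x\<ge>a. (D n has_real_derivative D (Suc n) x) (at x within {a..})))"

definition jacob_solution :: "(real \<Rightarrow> real) \<Rightarrow> real \<Rightarrow> real \<Rightarrow> real \<Rightarrow> bool" where
  "jacob_solution \<mu> y0 T x \<longleftrightarrow> y0 \<le> x \<and>
     integral {0..\<mu> x} (\<lambda>t. (cmod (hardy_Z t))\<^sup>2 * exp (- 2 * t / x)) =
     integral {0..T} (\<lambda>t. (cmod (hardy_Z t))\<^sup>2)"

definition jacobs_phi :: "(real \<Rightarrow> real) \<Rightarrow> real \<Rightarrow> real \<Rightarrow> real" where
  "jacobs_phi \<mu> y0 T = (THE x. jacob_solution \<mu> y0 T x)"

definition jacobs_ladder :: "(real \<Rightarrow> real) \<Rightarrow> real \<Rightarrow> real \<Rightarrow> real" where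
  "jacobs_ladder \<mu> y0 T = jacobs_phi \<mu> y0 T / 2"

text \<open>
  The asymptotic formula for \<open>\<phi>1'\<close> must be assumed wherever it is needed: it does not follow from
  \<open>\<mu>\<close> being smooth, increasing and \<open>\<ge> 7 y ln y\<close>, since the derivative in \<open>x\<close> of the left-hand integral
  of \<open>jacob_solution\<close> contains \<open>\<mu>'\<close>, which may have arbitrarily high peaks.
\<close>

text \<open>
  The point whose \<open>r\<close>-th iterate is \<open>T\<close>. As \<open>\<phi>1\<close> is meaningful (and injective) only on
  \<open>[T0, \<infinity>)\<close>, the orbit is required to stay there.
\<close>

definition ladder_preimage :: "real \<Rightarrow> (real \<Rightarrow> real) \<Rightarrow> nat \<Rightarrow> real \<Rightarrow> real" where
  "ladder_preimage T0 \<phi>1 r T =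
     (THE x. (\<forall>j<r. T0 \<le> (\<phi>1 ^^ j) x) \<and> (\<phi>1 ^^ r) x = T)"

text \<open>The growth condition \<open>U = o(T / ln T)\<close> is automatic here, since \<open>U\<close> does not depend on \<open>T\<close>.\<close>

definition C0_class :: "real \<Rightarrow> real \<Rightarrow> (real \<Rightarrow> real) set" where
  "C0_class T U = {f. continuous_on {T..T + U} f \<and>
     ((\<forall>t\<in>{T..T + U}. 0 \<le> f t) \<or> (\<forall>t\<in>{T..T + U}. f t \<le> 0)) \<and>
     (\<exists>t\<in>{T..T + U}. f t \<noteq> 0)}"

definition mean_value_point ::
    "real \<Rightarrow> (real \<Rightarrow> real) \<Rightarrow> real \<Rightarrow> real \<Rightarrow> nat \<Rightarrow> (real \<Rightarrow> real) \<Rightarrow> real \<Rightarrow> bool" where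
  "mean_value_point T0 \<phi>1 U T k f d \<longleftrightarrow>
     d \<in> {ladder_preimage T0 \<phi>1 k T <..< ladder_preimage T0 \<phi>1 k (T + U)} \<and>
     integral {T..T + U} f =
       f ((\<phi>1 ^^ k) d) * (\<Prod>r<k. deriv \<phi>1 ((\<phi>1 ^^ r) d)) *
       (ladder_preimage T0 \<phi>1 k (T + U) - ladder_preimage T0 \<phi>1 k T)"

text \<open>
  The points \<open>\<alpha>\<^sub>r\<close> (for \<open>x = d\<close>) and \<open>\<beta>\<^sub>r\<close> (for \<open>x = e\<close>), and the product
  of \<open>\<bar>\<zeta>(1/2 + i \<alpha>\<^sub>r) / \<zeta>(1/2 + i \<beta>\<^sub>r)\<bar>\<^sup>2\<close> over \<open>r = 1, ..., k\<close>.
\<close>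

definition assoc_point :: "(real \<Rightarrow> real) \<Rightarrow> nat \<Rightarrow> real \<Rightarrow> nat \<Rightarrow> real" where
  "assoc_point \<phi>1 k x r = (\<phi>1 ^^ (k - r)) x"

definition zeta_product :: "(real \<Rightarrow> real) \<Rightarrow> nat \<Rightarrow> real \<Rightarrow> real \<Rightarrow> real" where
  "zeta_product \<phi>1 k d e =
     (\<Prod>r=1..k. (cmod (zeta (Complex (1/2) (assoc_point \<phi>1 k d r)) /
                      zeta (Complex (1/2) (assoc_point \<phi>1 k e r))))\<^sup>2)"

end

theory Submission
  imports Defs "HOL-Real_Asymp.Real_Asymp"
begin

text \<open>
  Dividing the mean value formula for \<open>f\<close> by the one for \<open>1\<close> gives
  \<open>f(\<alpha>\<^sub>0) \<Prod> \<bar>\<zeta>(1/2 + i\<alpha>\<^sub>r) / \<zeta>(1/2 + i\<beta>\<^sub>r)\<bar>\<^sup>2 = (1/U) \<integral> f \<cdot> \<Prod> \<omega>(\<alpha>\<^sub>r) / \<omega>(\<beta>\<^sub>r)\<close>.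
  As \<open>\<omega>(t) \<sim> ln t\<close>, the last product tends to 1 once the logarithms of the two ends of each iterated
  preimage of \<open>[T, T + U]\<close> are asymptotic. For this no mean value asymptotics of \<open>\<zeta>\<close> are needed: the mean
  square of \<open>\<zeta>\<close> on the critical line over intervals of length \<open>2 ln T\<close> is bounded below by a power of
  \<open>1 / ln T\<close>, so a segment whose image under the ladder has length \<open>l\<close> is itself at most a power of
  \<open>ln T\<close> times \<open>1 + l\<close> long. The theorem is then an identity between the averages of the
  six functions over \<open>[0, U]\<close>.
\<close>

section \<open>The zeta-function on the critical line\<close>

text \<open>For \<open>1/2 \<le> Re s\<close> the terms of the continued series are at most
  \<open>cmod s\<close> times the summable \<open>?g n\<close>. The condition on \<open>Im s\<close>
  keeps \<open>s\<close> at distance at least 1 from the pole and gives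
  \<open>1 \<le> cmod s\<close>, so the pole term is absorbed by the constant.\<close>

lemma norm_zeta_le:
  "\<exists>C>0. \<forall>s. 1/2 \<le> Re s \<longrightarrow> 1 \<le> \<bar>Im s\<bar> \<longrightarrow> cmod (zeta s) \<le> C * cmod s"
proof (intro exI conjI allI impI)
  let ?g = "\<lambda>n. real (Suc n) powr (-3/2)"
  have sm: "summable ?g"
  proof -
    have "summable (\<lambda>n. real n powr (-3/2))" by (simp add: summable_real_powr_iff)
    then show ?thesis by (subst summable_Suc_iff[of "\<lambda>n. real n powr (-3/2)"])
  qed
  have S0: "0 \<le> (\<Sum>n. ?g n)" by (rule suminf_nonneg[OF sm]) simp
  then show "0 < 1 + (\<Sum>n. ?g n)" by linarith
  fix s :: complex assume s: "1/2 \<le> Re s" "1 \<le> \<bar>Im s\<bar>"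
  then have dom: "s \<in> zeta_domain" by (auto simp: zeta_domain_def)
  have n1: "1 \<le> cmod s" using s(2) abs_Im_le_cmod[of s] by linarith
  have n2: "1 \<le> cmod (s - 1)" using s(2) abs_Im_le_cmod[of "s - 1"] by simp
  have termbd: "norm (zeta_term n s) \<le> cmod s * ?g n" for n
  proof -
    have "norm (zeta_term n s) \<le> norm s * real (Suc n) powr (- Re s - 1)"
      by (rule norm_zeta_term_le[OF dom])
    also have "\<dots> \<le> cmod s * ?g n"
      using s by (intro mult_left_mono powr_mono) auto
    finally show ?thesis .
  qed
  have "cmod (\<Sum>n. zeta_term n s) \<le> (\<Sum>n. cmod s * ?g n)"
    by (rule norm_suminf_le[OF termbd summable_mult[OF sm]])
  also have "\<dots> = cmod s * (\<Sum>n. ?g n)" by (rule suminf_mult[OF sm])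
  finally have 1: "cmod (\<Sum>n. zeta_term n s) \<le> cmod s * (\<Sum>n. ?g n)" .
  have 2: "cmod (1 / (s - 1)) \<le> 1" using n2 by (simp add: norm_divide divide_le_eq)
  have "zeta s = 1 / (s - 1) + (\<Sum>n. zeta_term n s)"
    by (rule zeta_eqI[OF continues_zeta_series_exists dom])
  then have "cmod (zeta s) \<le> cmod (1 / (s - 1)) + cmod (\<Sum>n. zeta_term n s)"
    by (simp add: norm_triangle_ineq)
  with 1 2 n1 show "cmod (zeta s) \<le> (1 + (\<Sum>n. ?g n)) * cmod s"
    by (simp add: algebra_simps)
qed

text \<open>The Dirichlet series starts with 1, and the moduli of the remaining terms add up to
  pi^2/6 - 1, which is at most 3/4.\<close>

lemma Re_zeta_two_ge:
  assumes "Re s = 2"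
  shows "1/4 \<le> Re (zeta s)"
proof -
  let ?f = "\<lambda>n. 1 / (of_nat (Suc n) :: complex) powr s"
  have nf: "cmod (?f n) = 1 / (real (Suc n))\<^sup>2" for n
    using norm_powr_real_powr[of "of_nat (Suc n)" s] assms
    by (simp add: norm_divide norm_inverse)
  have sq: "(\<lambda>n. 1 / (real (Suc n))\<^sup>2) sums (pi\<^sup>2 / 6)"
    using inverse_squares_sums by (simp add: add.commute)
  then have smn: "summable (\<lambda>n. 1 / (real (Suc n))\<^sup>2)" by (rule sums_summable)
  then have sm: "summable ?f"
    by (intro summable_norm_cancel[where f = ?f]) (simp only: nf)
  have sq1: "(\<lambda>n. 1 / (real (Suc (Suc n)))\<^sup>2) sums (pi\<^sup>2 / 6 - 1)"
    using sq sums_Suc_iff[of "\<lambda>n. 1 / (real (Suc n))\<^sup>2" "pi\<^sup>2 / 6 - 1"] by simp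
  have "zeta s = (\<Sum>n. ?f n)" by (rule zeta_eq_series) (use assms in simp)
  also have "\<dots> = ?f 0 + (\<Sum>n. ?f (Suc n))" using suminf_split_head[OF sm] by simp
  finally have z: "zeta s = 1 + (\<Sum>n. ?f (Suc n))" by simp
  have "cmod (\<Sum>n. ?f (Suc n)) \<le> (\<Sum>n. 1 / (real (Suc (Suc n)))\<^sup>2)"
    by (rule norm_suminf_le[OF _ sums_summable[OF sq1]]) (simp only: nf order.refl)
  also have "\<dots> = pi\<^sup>2 / 6 - 1" using sq1 by (simp add: sums_iff)
  also have "\<dots> \<le> 3/4"
  proof -
    have "pi\<^sup>2 \<le> (3.2)\<^sup>2" using pi_approx by (intro power_mono) auto
    then show ?thesis by (simp add: power2_eq_square)
  qed
  finally show ?thesis using abs_Re_le_cmod[of "\<Sum>n. ?f (Suc n)"] z by simp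
qed

lemma continuous_on_zeta_vertical:
  assumes "0 < \<sigma>" "\<sigma> \<noteq> 1"
  shows "continuous_on {a..b} (\<lambda>t. zeta (Complex \<sigma> t))"
proof -
  have "continuous_on ({s. 0 < Re s} - {1}) zeta"
    by (rule holomorphic_on_imp_continuous_on[OF zeta_holomorphic])
  then show ?thesis
    by (rule continuous_on_compose2)
       (use assms in \<open>auto intro!: continuous_intros simp: complex_eq_iff\<close>)
qed

text \<open>
  Cauchy's theorem for \<open>\<zeta>(s) exp((s - s0)\<^sup>2)\<close>, \<open>s0 = 2 + i t0\<close>, on the rectangle between \<open>Re s = 1/2\<close> and
  \<open>Re s = 2\<close>. On the right side the real part of \<open>\<zeta>\<close> is at least \<open>1/4\<close>; on the horizontal sides the
  Gaussian beats the polynomial growth of \<open>\<zeta>\<close>.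
\<close>

lemma zeta_mean_lower_bound:
  "\<exists>c>0. \<forall>\<^sub>F t0 in at_top. \<forall>H. ln t0 \<le> H \<longrightarrow> H \<le> t0 - 1 \<longrightarrow>
     c \<le> integral {t0 - H..t0 + H} (\<lambda>t. cmod (zeta (Complex (1/2) t)))"
proof -
  obtain C where C: "C > 0" "\<And>s. 1/2 \<le> Re s \<Longrightarrow> 1 \<le> \<bar>Im s\<bar> \<Longrightarrow> cmod (zeta s) \<le> C * cmod s"
    using norm_zeta_le by blast
  \<comment> \<open>On \<open>Re s = 2\<close> the integral has real part at least
    \<open>exp (-1) / 2\<close>, of which the horizontal sides cost less than
    \<open>exp (-1) / 4\<close>. On the critical line the Gaussian factor is at most
    \<open>exp (9/4)\<close>.\<close>
  define c where "c = exp (-1) / 4 / exp (9/4 :: real)"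
  have c: "0 < c" by (simp add: c_def)
  \<comment> \<open>This is the total error \<open>3 * B\<close> of the two horizontal sides, each
    of length 3/2, for the least admissible \<open>H = ln t0\<close>. The factor exp(-(ln t)^2)
    decays faster than every power of t.\<close>
  have "((\<lambda>t::real. 3 * (4 * C * t * exp (9/4) * exp (- (ln t)\<^sup>2))) \<longlongrightarrow> 0) at_top"
    using C(1) by real_asymp
  then have "\<forall>\<^sub>F t in at_top. 3 * (4 * C * t * exp (9/4) * exp (- (ln t)\<^sup>2)) < exp (-1) / 4"
    by (rule order_tendstoD) simp
  moreover have "\<forall>\<^sub>F t::real in at_top. exp 1 \<le> t \<and> 4 \<le> t"
    by (intro eventually_conj eventually_ge_at_top)
  ultimately have "\<forall>\<^sub>F t0 in at_top. \<forall>H. ln t0 \<le> H \<longrightarrow> H \<le> t0 - 1 \<longrightarrow>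
     c \<le> integral {t0 - H..t0 + H} (\<lambda>t. cmod (zeta (Complex (1/2) t)))"
  proof (eventually_elim, intro allI impI)
    fix t0 H :: real
    assume small: "3 * (4 * C * t0 * exp (9/4) * exp (- (ln t0)\<^sup>2)) < exp (-1) / 4"
      and t0: "exp 1 \<le> t0 \<and> 4 \<le> t0" and H: "ln t0 \<le> H" "H \<le> t0 - 1"
    have l1: "1 \<le> ln t0" using t0 by (subst ln_ge_iff) auto
    have H1: "1 \<le> H" using l1 H by simp
    \<comment> \<open>The open quadrant is convex, avoids the pole and, since
      \<open>H \<le> t0 - 1\<close>, contains the rectangle. A primitive \<open>G\<close> of
      \<open>F\<close> on it reduces Cauchy's theorem to the values of \<open>G\<close> at the four
      corners.\<close>
    define S where "S = {s. 0 < Re s} \<inter> {s. 0 < Im s}"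
    define s0 where "s0 = Complex 2 t0"
    define F where "F = (\<lambda>s. zeta s * exp ((s - s0)\<^sup>2))"
    have "open S" "convex S" unfolding S_def
      by (auto intro!: open_Int convex_Int open_halfspace_Re_gt open_halfspace_Im_gt
            convex_halfspace_Re_gt convex_halfspace_Im_gt)
    moreover have holF: "F holomorphic_on S" unfolding F_def
      by (intro holomorphic_intros holomorphic_on_subset[OF zeta_holomorphic]) (auto simp: S_def)
    ultimately obtain G where "\<And>s. s \<in> S \<Longrightarrow> (G has_field_derivative F s) (at s within S)"
      using holomorphic_convex_primitive'[of S F] by blast
    then have G: "(G has_field_derivative F s) (at s)" if "s \<in> S" for s
      using that \<open>open S\<close> by (metis at_within_open)
    have vert: "((\<lambda>t. F (Complex \<sigma> t)) has_integral
          (G (Complex \<sigma> (t0 + H)) - G (Complex \<sigma> (t0 - H))) / \<i>) {t0 - H..t0 + H}"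
      if "0 < \<sigma>" for \<sigma>
    proof -
      have "((\<lambda>t. \<i> * F (Complex \<sigma> t)) has_integral
          (G (Complex \<sigma> (t0 + H)) - G (Complex \<sigma> (t0 - H)))) {t0 - H..t0 + H}"
      proof (rule fundamental_theorem_of_calculus)
        show "t0 - H \<le> t0 + H" using H1 by simp
        fix t assume t: "t \<in> {t0 - H..t0 + H}"
        then have inS: "Complex \<sigma> t \<in> S" using that H by (auto simp: S_def)
        have "((\<lambda>t. Complex \<sigma> t) has_vector_derivative \<i>) (at t within {t0 - H..t0 + H})"
          unfolding Complex_eq by (auto intro!: derivative_eq_intros)
        then have "((G \<circ> (\<lambda>t. Complex \<sigma> t)) has_vector_derivative \<i> * F (Complex \<sigma> t))
             (at t within {t0 - H..t0 + H})"
          by (rule field_vector_diff_chain_within) (auto intro: has_field_derivative_at_within G inS)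
        then show "((\<lambda>t. G (Complex \<sigma> t)) has_vector_derivative \<i> * F (Complex \<sigma> t))
             (at t within {t0 - H..t0 + H})" by (simp add: o_def)
      qed
      from has_integral_mult_right[OF this, of "- \<i>"] show ?thesis by simp
    qed
    \<comment> \<open>On the horizontal sides \<open>cmod s\<close> is at most
      \<open>4 * t0\<close>, and Re((s - s0)^2) = (Re s - 2)^2 - H^2 is at most 9/4 - H^2.\<close>
    define B where "B = 4 * C * t0 * exp (9/4) * exp (- H\<^sup>2)"
    have horiz: "cmod (G (Complex 2 y) - G (Complex (1/2) y)) \<le> B * (3/2)"
      if y: "y = t0 + H \<or> y = t0 - H" for y
    proof -
      have "cmod (G (Complex 2 y) - G (Complex (1/2) y)) \<le>
            B * cmod (Complex 2 y - Complex (1/2) y)"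
      proof (rule field_differentiable_bound[of "closed_segment (Complex (1/2) y) (Complex 2 y)"])
        fix s assume "s \<in> closed_segment (Complex (1/2) y) (Complex 2 y)"
        then obtain u where u: "0 \<le> u" "u \<le> 1"
          "s = (1 - u) *\<^sub>R Complex (1/2) y + u *\<^sub>R Complex 2 y"
          by (auto simp: closed_segment_def)
        then have Re: "Re s = 1/2 + 3/2 * u" and Im: "Im s = y" unfolding u(3) by (simp_all add: algebra_simps)
        have Re': "1/2 \<le> Re s" "Re s \<le> 2" using u Re by auto
        have yy: "1 \<le> y" "y \<le> 2 * t0" using y H H1 by auto
        show "(G has_field_derivative F s)
            (at s within closed_segment (Complex (1/2) y) (Complex 2 y))"
          by (rule has_field_derivative_at_within[OF G]) (use Re' Im yy in \<open>auto simp: S_def\<close>)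
        have "cmod s \<le> \<bar>Re s\<bar> + \<bar>Im s\<bar>" by (rule cmod_le)
        then have "cmod s \<le> 4 * t0" using Re' Im yy t0 by auto
        then have z: "cmod (zeta s) \<le> C * (4 * t0)"
          using C(2)[of s] Re' Im yy C(1) by (smt (verit) mult_left_mono)
        have "Re ((s - s0)\<^sup>2) = (Re s - 2)\<^sup>2 - H\<^sup>2"
          using y Im by (auto simp: s0_def power2_eq_square)
        also have "(Re s - 2)\<^sup>2 \<le> 9/4"
          using abs_le_square_iff[of "Re s - 2" "3/2"] Re' by (simp add: power2_eq_square)
        finally have "cmod (exp ((s - s0)\<^sup>2)) \<le> exp (9/4 - H\<^sup>2)" by simp
        then have e: "cmod (exp ((s - s0)\<^sup>2)) \<le> exp (9/4) * exp (- H\<^sup>2)"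
          by (simp add: exp_add[symmetric])
        show "cmod (F s) \<le> B"
          unfolding F_def B_def norm_mult using mult_mono[OF z e] C(1) t0 by (simp add: mult_ac)
      qed auto
      also have "cmod (Complex 2 y - Complex (1/2) y) = 3/2"
        by (simp add: cmod_def)
      finally show ?thesis .
    qed
    have "(ln t0)\<^sup>2 \<le> H\<^sup>2" using l1 H by (intro power_mono) auto
    then have "4 * C * t0 * exp (9/4) * exp (- H\<^sup>2) \<le> 4 * C * t0 * exp (9/4) * exp (- (ln t0)\<^sup>2)"
      using C(1) t0 by (intro mult_left_mono) auto
    then have B: "3 * B < exp (-1) / 4" using small unfolding B_def by linarith
    define I where "I = (\<lambda>\<sigma>. (G (Complex \<sigma> (t0 + H)) - G (Complex \<sigma> (t0 - H))) / \<i>)"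
    have "I 2 - I (1/2) = ((G (Complex 2 (t0 + H)) - G (Complex (1/2) (t0 + H))) -
        (G (Complex 2 (t0 - H)) - G (Complex (1/2) (t0 - H)))) / \<i>"
      by (simp add: I_def algebra_simps)
    then have "cmod (I 2 - I (1/2)) \<le> cmod (G (Complex 2 (t0 + H)) - G (Complex (1/2) (t0 + H))) +
        cmod (G (Complex 2 (t0 - H)) - G (Complex (1/2) (t0 - H)))"
      by (simp only: norm_divide norm_ii div_by_1) (rule norm_triangle_ineq4)
    also have "\<dots> \<le> 3 * B" using horiz[of "t0 + H"] horiz[of "t0 - H"] by simp
    finally have diff: "cmod (I 2 - I (1/2)) \<le> 3 * B" .
    have Re2: "exp (-1) / 2 \<le> Re (I 2)"
    proof -
      have reI: "((\<lambda>t. Re (F (Complex 2 t))) has_integral Re (I 2)) {t0 - H..t0 + H}"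
        using has_integral_Re[OF vert[of 2]] by (simp add: I_def)
      \<comment> \<open>On this line (s - s0)^2 is real and at most 0, so \<open>Re F\<close>
        inherits the positivity of the real part of zeta, and the integral may be cut down to
        \<open>{t0 - 1..t0 + 1}\<close>.\<close>
      have eqF: "Re (F (Complex 2 t)) = Re (zeta (Complex 2 t)) * exp (- (t - t0)\<^sup>2)" for t
      proof -
        have "(Complex 2 t - s0)\<^sup>2 = of_real (- (t - t0)\<^sup>2)"
          by (simp add: s0_def complex_eq_iff power2_eq_square)
        then show ?thesis by (simp add: F_def exp_of_real del: of_real_minus of_real_power)
      qed
      have nonneg: "0 \<le> Re (F (Complex 2 t))" for t
        unfolding eqF using Re_zeta_two_ge[of "Complex 2 t"] by simp
      have ion: "(\<lambda>t. Re (F (Complex 2 t))) integrable_on {t0 - H..t0 + H}" using reI by blast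
      have sub: "{t0 - 1..t0 + 1} \<subseteq> {t0 - H..t0 + H}" using H1 by auto
      have ion1: "(\<lambda>t. Re (F (Complex 2 t))) integrable_on {t0 - 1..t0 + 1}"
        using integrable_on_subinterval[OF ion sub] .
      have "integral {t0 - 1..t0 + 1} (\<lambda>t. exp (-1) / 4 :: real) \<le>
            integral {t0 - 1..t0 + 1} (\<lambda>t. Re (F (Complex 2 t)))"
      proof (rule integral_le[OF _ ion1])
        fix t assume t: "t \<in> {t0 - 1..t0 + 1}"
        then have "(t - t0)\<^sup>2 \<le> 1" using abs_le_square_iff[of "t - t0" 1] by auto
        then have "1/4 * exp (-1) \<le> Re (zeta (Complex 2 t)) * exp (- (t - t0)\<^sup>2)"
          using Re_zeta_two_ge[of "Complex 2 t"] by (intro mult_mono) auto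
        then show "exp (-1) / 4 \<le> Re (F (Complex 2 t))" unfolding eqF by simp
      qed auto
      also have "\<dots> \<le> integral {t0 - H..t0 + H} (\<lambda>t. Re (F (Complex 2 t)))"
        by (rule integral_subset_le[OF sub ion1 ion]) (use nonneg in auto)
      also have "\<dots> = Re (I 2)" using reI by (rule integral_unique)
      finally show ?thesis by simp
    qed
    have cz: "continuous_on {t0 - H..t0 + H} (\<lambda>t. zeta (Complex (1/2) t))"
      by (intro continuous_on_zeta_vertical) auto
    have "cmod (I (1/2)) \<le> integral {t0 - H..t0 + H} (\<lambda>t. exp (9/4) * cmod (zeta (Complex (1/2) t)))"
    proof -
      have v: "((\<lambda>t. F (Complex (1/2) t)) has_integral I (1/2)) {t0 - H..t0 + H}"
        using vert[of "1/2"] by (simp add: I_def)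
      have "norm (integral {t0 - H..t0 + H} (\<lambda>t. F (Complex (1/2) t))) \<le>
        integral {t0 - H..t0 + H} (\<lambda>t. exp (9/4) * cmod (zeta (Complex (1/2) t)))"
      proof (rule integral_norm_bound_integral)
        show "(\<lambda>t. F (Complex (1/2) t)) integrable_on {t0 - H..t0 + H}" using v by blast
        show "(\<lambda>t. exp (9/4) * cmod (zeta (Complex (1/2) t))) integrable_on {t0 - H..t0 + H}"
          by (intro integrable_continuous_interval continuous_intros cz)
        fix t
        have "Re ((Complex (1/2) t - s0)\<^sup>2) = 9/4 - (t - t0)\<^sup>2"
          by (simp add: s0_def power2_eq_square)
        then have "cmod (exp ((Complex (1/2) t - s0)\<^sup>2)) \<le> exp (9/4)" by simp
        then show "cmod (F (Complex (1/2) t)) \<le> exp (9/4) * cmod (zeta (Complex (1/2) t))"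
          unfolding F_def norm_mult by (simp add: mult.commute mult_left_mono del: norm_exp_eq_Re)
      qed
      then show ?thesis using integral_unique[OF v] by simp
    qed
    then have I1: "cmod (I (1/2)) \<le> exp (9/4) * integral {t0 - H..t0 + H} (\<lambda>t. cmod (zeta (Complex (1/2) t)))"
      by simp
    have "Re (I 2) \<le> cmod (I 2 - I (1/2)) + cmod (I (1/2))"
      using complex_Re_le_cmod[of "I 2"] norm_triangle_ineq[of "I 2 - I (1/2)" "I (1/2)"] by simp
    then have "exp (-1) / 4 \<le> exp (9/4) * integral {t0 - H..t0 + H} (\<lambda>t. cmod (zeta (Complex (1/2) t)))"
      using Re2 diff B I1 by linarith
    then show "c \<le> integral {t0 - H..t0 + H} (\<lambda>t. cmod (zeta (Complex (1/2) t)))"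
      unfolding c_def by (simp add: divide_le_eq mult.commute)
  qed
  with c show ?thesis by blast
qed

text \<open>Cauchy-Schwarz in pointwise form: completing the square gives z \<le> (H/c) z^2 + c/(4H)
  for z = |zeta|. Over an interval of length 2H the last term integrates to c/2, so half of the
  lower bound \<open>c\<close> for the first moment is left for the mean square.\<close>

lemma zeta_mean_square_lower_bound:
  "\<exists>c>0. \<forall>\<^sub>F t0 in at_top. \<forall>H. ln t0 \<le> H \<longrightarrow> H \<le> t0 - 1 \<longrightarrow>
     c / H \<le> integral {t0 - H..t0 + H} (\<lambda>t. (cmod (zeta (Complex (1/2) t)))\<^sup>2)"
proof -
  obtain c where c: "c > 0" and ev: "\<forall>\<^sub>F t0 in at_top. \<forall>H. ln t0 \<le> H \<longrightarrow> H \<le> t0 - 1 \<longrightarrow>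
     c \<le> integral {t0 - H..t0 + H} (\<lambda>t. cmod (zeta (Complex (1/2) t)))"
    using zeta_mean_lower_bound by blast
  have "\<forall>\<^sub>F t0 in at_top. \<forall>H. ln t0 \<le> H \<longrightarrow> H \<le> t0 - 1 \<longrightarrow>
     (c\<^sup>2 / 2) / H \<le> integral {t0 - H..t0 + H} (\<lambda>t. (cmod (zeta (Complex (1/2) t)))\<^sup>2)"
    using ev eventually_gt_at_top[of "1::real"]
  proof (eventually_elim, intro allI impI)
    fix t0 H :: real
    assume low: "\<forall>H. ln t0 \<le> H \<longrightarrow> H \<le> t0 - 1 \<longrightarrow>
        c \<le> integral {t0 - H..t0 + H} (\<lambda>t. cmod (zeta (Complex (1/2) t)))"
      and t0: "1 < t0" and H: "ln t0 \<le> H" "H \<le> t0 - 1"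
    have H0: "0 < H" using H(1) t0 ln_gt_zero[of t0] by linarith
    let ?z = "\<lambda>t. cmod (zeta (Complex (1/2) t))"
    have cz: "continuous_on {t0 - H..t0 + H} (\<lambda>t. zeta (Complex (1/2) t))"
      by (intro continuous_on_zeta_vertical) auto
    have "c \<le> integral {t0 - H..t0 + H} ?z" using low H by blast
    also have "\<dots> \<le> integral {t0 - H..t0 + H} (\<lambda>t. H / c * (?z t)\<^sup>2 + c / (4 * H))"
    proof (intro integral_le integrable_continuous_interval continuous_intros cz)
      fix t
      have "0 \<le> H / c * (?z t - c / (2 * H))\<^sup>2" using H0 c by simp
      also have "\<dots> = H / c * (?z t)\<^sup>2 + c / (4 * H) - ?z t"
        using H0 c by (simp add: power2_eq_square field_simps)
      finally show "?z t \<le> H / c * (?z t)\<^sup>2 + c / (4 * H)" by simp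
    qed
    also have "\<dots> = H / c * integral {t0 - H..t0 + H} (\<lambda>t. (?z t)\<^sup>2) + c / 2"
    proof (subst integral_add)
      show "(\<lambda>t. H / c * (?z t)\<^sup>2) integrable_on {t0 - H..t0 + H}"
        by (intro integrable_continuous_interval continuous_intros cz)
    qed (use H0 in auto)
    finally show "(c\<^sup>2 / 2) / H \<le> integral {t0 - H..t0 + H} (\<lambda>t. (?z t)\<^sup>2)"
      using H0 c by (simp add: field_simps power2_eq_square)
  qed
  with c show ?thesis by (intro exI[of _ "c\<^sup>2 / 2"]) auto
qed

lemma norm_hardy_Z: "cmod (hardy_Z t) = cmod (zeta (Complex (1/2) t))"
  by (simp add: hardy_Z_def norm_mult)

text \<open>A vanishing integral would make zeta vanish on a segment of the critical line, hence, by
  the identity theorem, also at 2, where its real part is at least 1/4.\<close>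

lemma integral_norm_zeta_square_pos:
  assumes "a < b"
  shows "0 < integral {a..b} (\<lambda>t. (cmod (zeta (Complex (1/2) t)))\<^sup>2)"
proof -
  let ?f = "\<lambda>t. (cmod (zeta (Complex (1/2) t)))\<^sup>2"
  have cont: "continuous_on {a..b} ?f"
    by (intro continuous_on_power continuous_on_norm continuous_on_zeta_vertical) auto
  have "0 \<le> integral {a..b} ?f" by (rule integral_nonneg[OF integrable_continuous_interval[OF cont]]) auto
  moreover have "integral {a..b} ?f \<noteq> 0"
  proof
    assume "integral {a..b} ?f = 0"
    then have "(?f has_integral 0) (cbox a b)"
      using integrable_integral[OF integrable_continuous_interval[OF cont]] by simp
    then have zero: "?f t = 0" if "t \<in> {a..b}" for t
      using has_integral_0_cbox_imp_0[of a b ?f t] cont that assms by auto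
    have "zeta 2 = 0"
    proof (rule analytic_continuation[OF zeta_holomorphic, of "Complex (1/2) ` {a..b}" "Complex (1/2) a"])
      show "open ({s. 0 < Re s} - {1})" "connected ({s. 0 < Re s} - {1})"
        using open_zeta_domain connected_zeta_domain by (simp_all add: zeta_domain_def)
      show "Complex (1/2) a islimpt Complex (1/2) ` {a..b}"
      proof (rule islimpt_isCont_image)
        show "a islimpt {a..b}" using assms by (simp add: islimpt_Icc)
        show "isCont (Complex (1/2)) a" unfolding Complex_eq by (intro continuous_intros)
        show "\<forall>\<^sub>F y in at a. Complex (1/2) y \<noteq> Complex (1/2) a"
          by (auto simp: eventually_at_filter)
      qed
    qed (use zero in \<open>auto simp: complex_eq_iff\<close>)
    then show False using Re_zeta_two_ge[of 2] by simp
  qed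
  ultimately show ?thesis by linarith
qed

section \<open>Jacob's ladder\<close>

text \<open>Two arguments with the same solution share the left-hand integral of
  \<open>jacob_solution\<close>, whereas the right-hand one is strictly increasing in
  \<open>T\<close>.\<close>

lemma inj_on_jacobs_ladder:
  assumes T0: "0 \<le> T0" and unique: "\<And>T. T0 \<le> T \<Longrightarrow> \<exists>!x. jacob_solution \<mu> y0 T x"
  shows "inj_on (jacobs_ladder \<mu> y0) {T0..}"
proof (rule linorder_inj_onI)
  let ?f = "\<lambda>t. (cmod (zeta (Complex (1/2) t)))\<^sup>2"
  have sol: "jacob_solution \<mu> y0 T (jacobs_phi \<mu> y0 T)" if "T0 \<le> T" for T
    unfolding jacobs_phi_def by (rule theI'[OF unique[OF that]])
  fix S T assume ST: "S < T" "S \<in> {T0..}" "T \<in> {T0..}"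
  show "jacobs_ladder \<mu> y0 S \<noteq> jacobs_ladder \<mu> y0 T"
  proof
    assume "jacobs_ladder \<mu> y0 S = jacobs_ladder \<mu> y0 T"
    then have "jacobs_phi \<mu> y0 S = jacobs_phi \<mu> y0 T" by (simp add: jacobs_ladder_def)
    then have "integral {0..S} ?f = integral {0..T} ?f"
      using sol[of S] sol[of T] ST by (simp add: jacob_solution_def norm_hardy_Z)
    moreover have "?f integrable_on {0..T}"
      by (intro integrable_continuous_interval continuous_on_power continuous_on_norm
            continuous_on_zeta_vertical) auto
    then have "integral {0..S} ?f + integral {S..T} ?f = integral {0..T} ?f"
      using ST T0 by (intro Henstock_Kurzweil_Integration.integral_combine) auto
    ultimately show False using integral_norm_zeta_square_pos[OF ST(1)] by linarith
  qed
qed (auto simp: linorder_class.linear)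

lemma funpow_Suc_right_apply: "(f ^^ Suc n) x = (f ^^ n) (f x)"
  by (simp add: funpow_swap1)

text \<open>A gap bounded by a power of \<open>ln q\<close> is o(q), so eventually q \<le> 2p and
  \<open>ln q\<close> exceeds \<open>ln p\<close> by at most \<open>ln 2\<close>.\<close>

lemma ln_ratio_tendsto_1:
  fixes p q :: "'a \<Rightarrow> real"
  assumes pq: "\<forall>\<^sub>F L in F. p L \<le> q L" and gap: "\<forall>\<^sub>F L in F. q L - p L \<le> C * ln (q L) ^ m"
    and p: "filterlim p at_top F"
  shows "((\<lambda>L. ln (q L) / ln (p L)) \<longlongrightarrow> 1) F"
proof -
  have q: "filterlim q at_top F" by (rule filterlim_at_top_mono[OF p pq])
  have "((\<lambda>x::real. C * ln x ^ m / x) \<longlongrightarrow> 0) at_top" by real_asymp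
  then have "\<forall>\<^sub>F x in at_top. C * ln x ^ m / x < 1/2" by (rule order_tendstoD) simp
  then have "\<forall>\<^sub>F L in F. C * ln (q L) ^ m / q L < 1/2" using q by (rule eventually_compose_filterlim)
  moreover have "\<forall>\<^sub>F L in F. 1 < p L"
    using p by (simp add: filterlim_at_top_dense)
  ultimately have bounds: "\<forall>\<^sub>F L in F. 1 \<le> ln (q L) / ln (p L) \<and>
      ln (q L) / ln (p L) \<le> 1 + ln 2 / ln (p L)"
    using pq gap
  proof eventually_elim
    fix L assume *: "C * ln (q L) ^ m / q L < 1/2" "1 < p L" "p L \<le> q L"
      "q L - p L \<le> C * ln (q L) ^ m"
    then have "C * ln (q L) ^ m < q L / 2" by (simp add: divide_less_eq)
    then have "q L \<le> 2 * p L" using * by linarith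
    then have "ln (q L) \<le> ln (2 * p L)" using * by simp
    also have "\<dots> = ln 2 + ln (p L)" using * by (intro ln_mult_pos) auto
    finally show "1 \<le> ln (q L) / ln (p L) \<and> ln (q L) / ln (p L) \<le> 1 + ln 2 / ln (p L)"
      using * by (simp add: field_simps)
  qed
  have "filterlim (\<lambda>L. ln (p L)) at_top F" by (rule filterlim_compose[OF ln_at_top p])
  then have "((\<lambda>L. 1 + ln 2 / ln (p L)) \<longlongrightarrow> 1 + 0) F"
    by (intro tendsto_add tendsto_const real_tendsto_divide_at_top[OF tendsto_const])
  then have "((\<lambda>L. 1 + ln 2 / ln (p L)) \<longlongrightarrow> 1) F" by simp
  show ?thesis
    by (rule tendsto_sandwich[OF _ _ tendsto_const[of 1] \<open>((\<lambda>L. 1 + ln 2 / ln (p L)) \<longlongrightarrow> 1) F\<close>])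
       (use bounds in \<open>auto elim: eventually_mono\<close>)
qed

text \<open>Separates the ladder from its definition. Injectivity gives unique preimages and, with
  the sign of the derivative, strict monotonicity; the derivative gives the size estimates; \<omega>
  is known to leading order.\<close>

locale ladder =
  fixes \<phi> \<omega> :: "real \<Rightarrow> real" and T0 :: real
  assumes inj: "inj_on \<phi> {T0..}"
    and deriv: "\<forall>\<^sub>F t in at_top.
          (\<phi> has_real_derivative (cmod (zeta (Complex (1/2) t)))\<^sup>2 / \<omega> t) (at t)"
    and omega: "((\<lambda>t. \<omega> t / ln t) \<longlongrightarrow> 1) at_top"
begin

section \<open>Monotonicity and growth of the ladder\<close>

lemma eventually_omega_bounds: "\<forall>\<^sub>F t in at_top. 1 \<le> \<omega> t \<and> \<omega> t \<le> 2 * ln t"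
proof -
  have "\<forall>\<^sub>F t in at_top. 1/2 < \<omega> t / ln t" "\<forall>\<^sub>F t in at_top. \<omega> t / ln t < 2"
    by (rule order_tendstoD[OF omega]; simp)+
  moreover have "\<forall>\<^sub>F t::real in at_top. 2 \<le> ln t" by real_asymp
  ultimately show ?thesis
    by eventually_elim (auto simp: field_simps)
qed

lemma eventually_nondecreasing: "\<forall>\<^sub>F x in at_top. \<forall>y\<ge>x. \<phi> x \<le> \<phi> y"
proof -
  have "\<forall>\<^sub>F x in at_top. \<forall>t\<ge>x. 1 \<le> \<omega> t \<and>
      (\<phi> has_real_derivative (cmod (zeta (Complex (1/2) t)))\<^sup>2 / \<omega> t) (at t)"
    using eventually_conj[OF eventually_omega_bounds deriv]
    by (intro eventually_all_ge_at_top) (auto elim: eventually_mono)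
  then show ?thesis
  proof eventually_elim
    case (elim x)
    show ?case
    proof (intro allI impI)
      fix y assume "x \<le> y"
      show "\<phi> x \<le> \<phi> y"
      proof (rule DERIV_nonneg_imp_nondecreasing[OF \<open>x \<le> y\<close>])
        fix t assume t: "x \<le> t"
        then have "1 \<le> \<omega> t" using elim by blast
        then have "0 \<le> (cmod (zeta (Complex (1/2) t)))\<^sup>2 / \<omega> t" by simp
        then show "\<exists>D. (\<phi> has_real_derivative D) (at t) \<and> 0 \<le> D" using elim t by blast
      qed
    qed
  qed
qed

text \<open>The derivative vanishes wherever zeta has a zero on the critical line, so strictness is
  taken from injectivity instead.\<close>

lemma eventually_strict_mono: "\<forall>\<^sub>F x in at_top. \<forall>y>x. \<phi> x < \<phi> y"
  using eventually_nondecreasing eventually_ge_at_top[of T0]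
proof eventually_elim
  case (elim x)
  show ?case
  proof (intro allI impI)
    fix y assume "x < y"
    then have "\<phi> x \<le> \<phi> y" "\<phi> x \<noteq> \<phi> y" using elim inj by (auto dest: inj_onD)
    then show "\<phi> x < \<phi> y" by simp
  qed
qed

text \<open>
  Each of the roughly \<open>(y - x) / (2 ln y)\<close> blocks of length \<open>2 ln y\<close> between \<open>x\<close> and \<open>y\<close> contributes
  at least a constant times \<open>1 / (ln y)\<^sup>2\<close> to \<open>\<phi> y - \<phi> x\<close>.
\<close>

lemma gap_bound:
  "\<exists>C>0. \<forall>\<^sub>F x in at_top. \<forall>y\<ge>x. y - x \<le> C * ln y ^ 3 * (1 + (\<phi> y - \<phi> x))"
proof -
  let ?z = "\<lambda>t. (cmod (zeta (Complex (1/2) t)))\<^sup>2"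
  obtain c where c: "c > 0" and low: "\<forall>\<^sub>F t0 in at_top. \<forall>H. ln t0 \<le> H \<longrightarrow> H \<le> t0 - 1 \<longrightarrow>
     c / H \<le> integral {t0 - H..t0 + H} ?z"
    using zeta_mean_square_lower_bound by blast
  have "\<forall>\<^sub>F x in at_top. \<forall>t\<ge>x. (1 \<le> \<omega> t \<and> \<omega> t \<le> 2 * ln t) \<and> (\<phi> has_real_derivative ?z t / \<omega> t) (at t) \<and>
      (\<forall>H. ln t \<le> H \<longrightarrow> H \<le> t - 1 \<longrightarrow> c / H \<le> integral {t - H..t + H} ?z) \<and> (\<forall>y\<ge>t. \<phi> t \<le> \<phi> y)"
    by (intro eventually_all_ge_at_top eventually_conj eventually_omega_bounds deriv low eventually_nondecreasing)
  moreover have "\<forall>\<^sub>F x::real in at_top. exp 1 \<le> x \<and> 1 \<le> x"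
    by (intro eventually_conj eventually_ge_at_top)
  \<comment> \<open>The summand \<open>4 / c\<close> comes from counting the complete blocks, the
    summand \<open>2\<close> from the one incomplete block at the end.\<close>
  ultimately have "\<forall>\<^sub>F x in at_top. \<forall>y\<ge>x. y - x \<le> (2 + 4 / c) * ln y ^ 3 * (1 + (\<phi> y - \<phi> x))"
  proof (eventually_elim, intro allI impI)
    fix x y
    assume ev: "\<forall>t\<ge>x. (1 \<le> \<omega> t \<and> \<omega> t \<le> 2 * ln t) \<and> (\<phi> has_real_derivative ?z t / \<omega> t) (at t) \<and>
      (\<forall>H. ln t \<le> H \<longrightarrow> H \<le> t - 1 \<longrightarrow> c / H \<le> integral {t - H..t + H} ?z) \<and> (\<forall>y\<ge>t. \<phi> t \<le> \<phi> y)"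
      and x: "exp 1 \<le> x \<and> 1 \<le> x" and xy: "x \<le> y"
    \<comment> \<open>One half-length serves all blocks: the centre of a block lies below
      \<open>y\<close>, so its logarithm is at most \<open>H\<close> and the mean square bound
      \<open>c / H\<close> applies. Since \<omega>(t) \<le> 2 ln t \<le> 2H, the ladder grows by at
      least c/(2H^2) over the block.\<close>
    define H where "H = ln y"
    have H1: "1 \<le> H" unfolding H_def using x xy by (subst ln_ge_iff) auto
    have step: "c / (2 * H\<^sup>2) \<le> \<phi> (a + 2 * H) - \<phi> a" if a: "x \<le> a" "a + 2 * H \<le> y" for a
    proof -
      have \<phi>_int: "((\<lambda>t. ?z t / \<omega> t) has_integral (\<phi> (a + 2 * H) - \<phi> a)) {a..a + 2 * H}"
      proof (rule fundamental_theorem_of_calculus)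
        show "a \<le> a + 2 * H" using H1 by simp
        fix t assume "t \<in> {a..a + 2 * H}"
        then have "(\<phi> has_real_derivative ?z t / \<omega> t) (at t)" using ev a by auto
        then show "(\<phi> has_vector_derivative ?z t / \<omega> t) (at t within {a..a + 2 * H})"
          by (simp add: has_real_derivative_iff_has_vector_derivative has_vector_derivative_at_within)
      qed
      have "?z integrable_on {a..a + 2 * H}"
        by (intro integrable_continuous_interval continuous_on_power continuous_on_norm
              continuous_on_zeta_vertical) auto
      then have z_int: "((\<lambda>t. ?z t / (2 * H)) has_integral (integral {a..a + 2 * H} ?z / (2 * H))) {a..a + 2 * H}"
        by (intro has_integral_divide integrable_integral)
      have "integral {a..a + 2 * H} ?z / (2 * H) \<le> \<phi> (a + 2 * H) - \<phi> a"
      proof (rule has_integral_le[OF z_int \<phi>_int])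
        fix t assume t: "t \<in> {a..a + 2 * H}"
        then have "1 \<le> \<omega> t" "\<omega> t \<le> 2 * ln t" using ev a by auto
        moreover have "ln t \<le> H" unfolding H_def using t a x by auto
        ultimately show "?z t / (2 * H) \<le> ?z t / \<omega> t" by (intro divide_left_mono) auto
      qed
      moreover have "c / H \<le> integral {a + H - H..a + H + H} ?z"
      proof -
        have "x \<le> a + H" using a H1 by simp
        moreover have "ln (a + H) \<le> H" unfolding H_def using a H1 x
          by (subst ln_le_cancel_iff) (auto simp: H_def)
        moreover have "H \<le> a + H - 1" using a x by simp
        ultimately show ?thesis using ev by blast
      qed
      then have "c / H / (2 * H) \<le> integral {a..a + 2 * H} ?z / (2 * H)"
        using H1 by (intro divide_right_mono) (auto simp: algebra_simps)
      ultimately show ?thesis by (simp add: power2_eq_square mult_ac)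
    qed
    have steps: "real n * (c / (2 * H\<^sup>2)) \<le> \<phi> (x + 2 * H * real n) - \<phi> x"
      if "x + 2 * H * real n \<le> y" for n
      using that
    proof (induction n)
      case (Suc n)
      have "0 \<le> H * real n" using H1 by simp
      then have "c / (2 * H\<^sup>2) \<le> \<phi> (x + 2 * H * real n + 2 * H) - \<phi> (x + 2 * H * real n)"
        using Suc.prems by (intro step) (auto simp: algebra_simps)
      moreover have "real n * (c / (2 * H\<^sup>2)) \<le> \<phi> (x + 2 * H * real n) - \<phi> x"
        using Suc.prems H1 by (intro Suc.IH) (auto simp: algebra_simps)
      moreover have "x + 2 * H * real n + 2 * H = x + 2 * H * real (Suc n)"
        "real (Suc n) * (c / (2 * H\<^sup>2)) = real n * (c / (2 * H\<^sup>2)) + c / (2 * H\<^sup>2)"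
        by (simp_all add: distrib_left distrib_right add_divide_distrib)
      ultimately show ?case by simp
    qed simp
    define n where "n = nat \<lfloor>(y - x) / (2 * H)\<rfloor>"
    have "0 \<le> (y - x) / (2 * H)" using xy H1 by simp
    then have n: "real n \<le> (y - x) / (2 * H)" "(y - x) / (2 * H) \<le> real n + 1"
      unfolding n_def by linarith+
    have n1: "x + 2 * H * real n \<le> y" using n(1) H1 by (simp add: field_simps)
    have "real n * (c / (2 * H\<^sup>2)) \<le> \<phi> (x + 2 * H * real n) - \<phi> x" by (rule steps[OF n1])
    also have "\<phi> (x + 2 * H * real n) \<le> \<phi> y" using ev n1 H1 by simp
    finally have "real n * (c / (2 * H\<^sup>2)) \<le> \<phi> y - \<phi> x" by simp
    then have n2: "real n \<le> 2 * H\<^sup>2 / c * (\<phi> y - \<phi> x)" using H1 c by (simp add: field_simps)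
    have "y - x \<le> 2 * H * (real n + 1)" using n(2) H1 by (simp add: field_simps)
    also have "\<dots> \<le> 2 * H * (2 * H\<^sup>2 / c * (\<phi> y - \<phi> x) + 1)"
      using n2 H1 by (intro mult_left_mono) auto
    also have "\<dots> = 4 / c * H ^ 3 * (\<phi> y - \<phi> x) + 2 * H"
      by (simp add: power2_eq_square power3_eq_cube algebra_simps)
    also have "\<dots> \<le> (2 + 4 / c) * H ^ 3 * (1 + (\<phi> y - \<phi> x))"
    proof -
      have "H \<le> H ^ 3" using H1 self_le_power[of H 3] by simp
      moreover have "0 \<le> \<phi> y - \<phi> x" using ev xy by auto
      then have "0 \<le> 4 / c * H ^ 3" "0 \<le> H ^ 3 * (\<phi> y - \<phi> x)" using c H1 by auto
      moreover have "(2 + K) * H ^ 3 * (1 + w) = 2 * H ^ 3 + K * H ^ 3 + 2 * (H ^ 3 * w) + K * H ^ 3 * w" for K w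
        by (simp add: algebra_simps)
      ultimately show ?thesis by simp
    qed
    finally show "y - x \<le> (2 + 4 / c) * ln y ^ 3 * (1 + (\<phi> y - \<phi> x))" unfolding H_def .
  qed
  with c show ?thesis by (intro exI[of _ "2 + 4 / c"]) (auto intro: add_pos_pos)
qed

text \<open>With \<open>x\<close> fixed, \<open>gap_bound\<close> reads as a lower bound for
  \<phi>(y) of order y / (ln y)^3.\<close>

lemma tendsto_at_top: "filterlim \<phi> at_top at_top"
proof -
  obtain C where C: "C > 0"
    and ev: "\<forall>\<^sub>F x in at_top. \<forall>y\<ge>x. y - x \<le> C * ln y ^ 3 * (1 + (\<phi> y - \<phi> x))"
    using gap_bound by blast
  from eventually_conj[OF ev eventually_ge_at_top[of "2::real"]]
  obtain x where x: "\<forall>y\<ge>x. y - x \<le> C * ln y ^ 3 * (1 + (\<phi> y - \<phi> x))" "2 \<le> x"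
    by (auto dest: eventually_happens)
  have "filterlim (\<lambda>y::real. (y - x) / (C * ln y ^ 3) + (\<phi> x - 1)) at_top at_top"
    using C by real_asymp
  then show ?thesis
  proof (rule filterlim_at_top_mono)
    show "\<forall>\<^sub>F y in at_top. (y - x) / (C * ln y ^ 3) + (\<phi> x - 1) \<le> \<phi> y"
      using eventually_ge_at_top[of x]
    proof eventually_elim
      case (elim y)
      then have "0 < C * ln y ^ 3" using x C by simp
      moreover have "y - x \<le> C * ln y ^ 3 * (1 + (\<phi> y - \<phi> x))" using x elim by blast
      ultimately have "(y - x) / (C * ln y ^ 3) \<le> 1 + (\<phi> y - \<phi> x)"
        by (simp add: divide_le_eq mult_ac)
      then show ?case by simp
    qed
  qed
qed

text \<open>By the linear bound for zeta and \<omega> \<ge> 1, the derivative is O(y^2), so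
  \<phi>(y) is O(y^3). This serves to compare ln \<phi>(y) with 4 ln y.\<close>

lemma polynomial_growth: "\<forall>\<^sub>F y in at_top. \<phi> y \<le> y ^ 4"
proof -
  obtain C where C: "C > 0" "\<And>s. 1/2 \<le> Re s \<Longrightarrow> 1 \<le> \<bar>Im s\<bar> \<Longrightarrow> cmod (zeta s) \<le> C * cmod s"
    using norm_zeta_le by blast
  have "\<forall>\<^sub>F x in at_top. (\<forall>t\<ge>x. (1 \<le> \<omega> t \<and> \<omega> t \<le> 2 * ln t) \<and>
      (\<phi> has_real_derivative (cmod (zeta (Complex (1/2) t)))\<^sup>2 / \<omega> t) (at t)) \<and> 1 \<le> x"
    by (intro eventually_all_ge_at_top eventually_conj eventually_omega_bounds deriv eventually_ge_at_top)
  then obtain x where x: "1 \<le> x" "\<And>t. x \<le> t \<Longrightarrow> 1 \<le> \<omega> t"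
    "\<And>t. x \<le> t \<Longrightarrow> (\<phi> has_real_derivative (cmod (zeta (Complex (1/2) t)))\<^sup>2 / \<omega> t) (at t)"
    by (auto dest!: eventually_happens)
  have bound: "\<phi> y \<le> \<phi> x + (2 * C * y)\<^sup>2 * (y - x)" if xy: "x < y" for y
  proof -
    obtain t where t: "x < t" "t < y"
      "\<phi> y - \<phi> x = (y - x) * ((cmod (zeta (Complex (1/2) t)))\<^sup>2 / \<omega> t)"
      using MVT2[OF xy x(3)] by blast
    have "cmod (Complex (1/2) t) \<le> 1/2 + t" using cmod_le[of "Complex (1/2) t"] t x by simp
    also have "\<dots> \<le> 2 * y" using t x by simp
    finally have "cmod (zeta (Complex (1/2) t)) \<le> C * (2 * y)"
      using C(2)[of "Complex (1/2) t"] t x C(1) by (smt (verit) complex.sel mult_left_mono)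
    then have "(cmod (zeta (Complex (1/2) t)))\<^sup>2 \<le> (2 * C * y)\<^sup>2"
      by (intro power_mono) (auto simp: mult_ac)
    moreover have "(cmod (zeta (Complex (1/2) t)))\<^sup>2 / \<omega> t \<le> (cmod (zeta (Complex (1/2) t)))\<^sup>2"
      using x(2)[of t] t mult_left_mono[of 1 "\<omega> t" "(cmod (zeta (Complex (1/2) t)))\<^sup>2"] by (simp add: divide_le_eq)
    ultimately have "\<phi> y - \<phi> x \<le> (y - x) * (2 * C * y)\<^sup>2"
      unfolding t(3) using xy by (intro mult_left_mono) auto
    then show ?thesis by (simp add: mult.commute)
  qed
  have "\<forall>\<^sub>F y::real in at_top. \<phi> x + (2 * C * y)\<^sup>2 * (y - x) \<le> y ^ 4" using C(1) by real_asymp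
  then show ?thesis using eventually_gt_at_top[of x]
    by eventually_elim (use bound in force)
qed

section \<open>Iterated preimages of the interval\<close>

text \<open>Existence comes from pulling \<open>T\<close> back one step at a time by the
  intermediate value theorem; uniqueness comes from injectivity along orbits that stay above
  \<open>T0\<close>. The bound \<open>X\<close> is free, so every eventual property of the ladder
  can be used along the whole orbit.\<close>

lemma eventually_ladder_preimage:
  "\<forall>\<^sub>F T in at_top. (\<forall>j\<le>k. X \<le> (\<phi> ^^ j) (ladder_preimage T0 \<phi> k T)) \<and>
     (\<phi> ^^ k) (ladder_preimage T0 \<phi> k T) = T"
proof -
  have ex: "\<forall>\<^sub>F T in at_top. \<exists>x. (\<forall>j\<le>k. X \<le> (\<phi> ^^ j) x) \<and> (\<phi> ^^ k) x = T" for X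
  proof (induction k arbitrary: X)
    case 0
    show ?case using eventually_ge_at_top[of X] by eventually_elim auto
  next
    case (Suc k)
    have "\<forall>\<^sub>F t in at_top. isCont \<phi> t" using deriv by eventually_elim (rule DERIV_isCont)
    then have "\<forall>\<^sub>F x in at_top. (\<forall>t\<ge>x. isCont \<phi> t) \<and> X \<le> x"
      by (intro eventually_conj eventually_all_ge_at_top eventually_ge_at_top)
    then obtain Y where Y: "X \<le> Y" "\<And>t. Y \<le> t \<Longrightarrow> isCont \<phi> t"
      by (auto dest!: eventually_happens)
    \<comment> \<open>The bound \<open>Y\<close> keeps the old orbit in the range of continuity and
      above \<open>X\<close>; the bound \<open>\<phi> Y\<close> makes \<open>Y\<close> a valid left
      end for the intermediate value theorem.\<close>
    show ?case using Suc.IH[of "max Y (\<phi> Y)"]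
    proof eventually_elim
      case (elim T)
      then obtain x where x: "\<forall>j\<le>k. max Y (\<phi> Y) \<le> (\<phi> ^^ j) x" "(\<phi> ^^ k) x = T" by blast
      have "\<phi> Y \<le> x" using x(1) by (metis funpow_0 le0 max.bounded_iff)
      have "\<forall>\<^sub>F b in at_top. x \<le> \<phi> b \<and> Y \<le> b"
        using tendsto_at_top by (intro eventually_conj eventually_ge_at_top) (simp add: filterlim_at_top)
      then obtain b where "x \<le> \<phi> b" "Y \<le> b" by (auto dest!: eventually_happens)
      with \<open>\<phi> Y \<le> x\<close> obtain w where w: "Y \<le> w" "\<phi> w = x"
        using IVT[of \<phi> Y x b] Y(2) by auto
      have "X \<le> (\<phi> ^^ j) w" if "j \<le> Suc k" for j
      proof (cases j)
        case 0
        then show ?thesis using w Y by simp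
      next
        case (Suc i)
        then have "Y \<le> (\<phi> ^^ i) x" using x(1) that by auto
        then show ?thesis unfolding Suc funpow_Suc_right_apply w(2) using Y(1) by simp
      qed
      moreover have "(\<phi> ^^ Suc k) w = T" unfolding funpow_Suc_right_apply w(2) by (rule x(2))
      ultimately show ?case by blast
    qed
  qed
  have uniq: "x = y" if "\<forall>j<k. T0 \<le> (\<phi> ^^ j) x" "\<forall>j<k. T0 \<le> (\<phi> ^^ j) y" "(\<phi> ^^ k) x = (\<phi> ^^ k) y" for x y k
    using that
  proof (induction k)
    case (Suc k)
    then have "(\<phi> ^^ k) x = (\<phi> ^^ k) y" using inj_onD[OF inj, of "(\<phi> ^^ k) x" "(\<phi> ^^ k) y"] by simp
    then show ?case using Suc by simp
  qed simp
  \<comment> \<open>Including \<open>T0\<close> in the bound makes the orbit found here meet the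
    requirement in \<open>ladder_preimage\<close>, so this point is the one described there.\<close>
  show ?thesis using ex[of "max X T0"]
  proof eventually_elim
    case (elim T)
    then obtain x where x: "\<forall>j\<le>k. max X T0 \<le> (\<phi> ^^ j) x" "(\<phi> ^^ k) x = T" by blast
    have "ladder_preimage T0 \<phi> k T = x"
      unfolding ladder_preimage_def
    proof (rule the_equality)
      show "(\<forall>j<k. T0 \<le> (\<phi> ^^ j) x) \<and> (\<phi> ^^ k) x = T" using x by auto
      show "y = x" if "(\<forall>j<k. T0 \<le> (\<phi> ^^ j) y) \<and> (\<phi> ^^ k) y = T" for y
        by (rule uniq[of k]) (use that x in auto)
    qed
    with x show ?case by simp
  qed
qed

text \<open>By induction the gap between \<phi>(p) and \<phi>(q) is at most a power of ln \<phi>(q),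
  which by \<open>polynomial_growth\<close> is a power of \<open>ln q\<close> up to a constant. One
  use of \<open>gap_bound\<close> then costs three more logarithms. \<open>0 \<le> C\<close> allows
  the replacement of ln \<phi>(q) by its upper bound 4 ln q.\<close>

lemma iterated_gap_bound:
  "\<exists>C m. 0 \<le> C \<and> (\<forall>\<^sub>F X in at_top. \<forall>p q. (\<forall>j\<le>k. X \<le> (\<phi> ^^ j) p) \<longrightarrow> p \<le> q \<longrightarrow>
     (\<phi> ^^ k) q - (\<phi> ^^ k) p \<le> U \<longrightarrow> q - p \<le> C * ln q ^ m)"
proof (induction k)
  case 0
  show ?case by (rule exI[of _ "\<bar>U\<bar>"], rule exI[of _ 0]) auto
next
  case (Suc k)
  then obtain C m where C: "0 \<le> C" and IH: "\<forall>\<^sub>F X in at_top. \<forall>p q. (\<forall>j\<le>k. X \<le> (\<phi> ^^ j) p) \<longrightarrow> p \<le> q \<longrightarrow>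
     (\<phi> ^^ k) q - (\<phi> ^^ k) p \<le> U \<longrightarrow> q - p \<le> C * ln q ^ m" by blast
  obtain B where B: "0 < B" and gap: "\<forall>\<^sub>F x in at_top. \<forall>y\<ge>x. y - x \<le> B * ln y ^ 3 * (1 + (\<phi> y - \<phi> x))"
    using gap_bound by blast
  have "\<forall>\<^sub>F X in at_top. \<forall>p q. (\<forall>j\<le>Suc k. X \<le> (\<phi> ^^ j) p) \<longrightarrow> p \<le> q \<longrightarrow>
     (\<phi> ^^ Suc k) q - (\<phi> ^^ Suc k) p \<le> U \<longrightarrow> q - p \<le> (B * (1 + C * 4 ^ m)) * ln q ^ (m + 3)"
    using IH eventually_all_ge_at_top[OF gap] eventually_all_ge_at_top[OF eventually_nondecreasing]
      eventually_all_ge_at_top[OF polynomial_growth] eventually_ge_at_top[of "exp 1"]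
  proof (eventually_elim, intro allI impI)
    fix X p q
    assume IH: "\<forall>p q. (\<forall>j\<le>k. X \<le> (\<phi> ^^ j) p) \<longrightarrow> p \<le> q \<longrightarrow>
         (\<phi> ^^ k) q - (\<phi> ^^ k) p \<le> U \<longrightarrow> q - p \<le> C * ln q ^ m"
      and gap: "\<forall>x\<ge>X. \<forall>y\<ge>x. y - x \<le> B * ln y ^ 3 * (1 + (\<phi> y - \<phi> x))"
      and mono: "\<forall>x\<ge>X. \<forall>y\<ge>x. \<phi> x \<le> \<phi> y" and growth: "\<forall>y\<ge>X. \<phi> y \<le> y ^ 4" and X: "exp 1 \<le> X"
      and orbit: "\<forall>j\<le>Suc k. X \<le> (\<phi> ^^ j) p" and pq: "p \<le> q"
      and U: "(\<phi> ^^ Suc k) q - (\<phi> ^^ Suc k) p \<le> U"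
    have p: "X \<le> p" using orbit by (metis funpow_0 le0)
    have orbit': "X \<le> (\<phi> ^^ j) (\<phi> p)" if "j \<le> k" for j
      using orbit[rule_format, of "Suc j"] that unfolding funpow_Suc_right_apply by simp
    have \<phi>p: "X \<le> \<phi> p" using orbit'[of 0] by simp
    have \<phi>pq: "\<phi> p \<le> \<phi> q" using mono p pq by blast
    have l1: "1 \<le> ln q" using X p pq by (subst ln_ge_iff) (auto intro: order_less_le_trans[of 0 "exp 1"])
    have q0: "0 < q" "0 < \<phi> q" using X p pq \<phi>p \<phi>pq exp_gt_zero[of "1::real"] by linarith+
    have "(\<phi> ^^ k) (\<phi> q) - (\<phi> ^^ k) (\<phi> p) \<le> U" using U unfolding funpow_Suc_right_apply .
    then have "\<phi> q - \<phi> p \<le> C * ln (\<phi> q) ^ m" using IH orbit' \<phi>pq by blast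
    also have "\<dots> \<le> C * (4 * ln q) ^ m"
    proof (intro mult_left_mono power_mono C)
      have "ln (\<phi> q) \<le> ln (q ^ 4)" using growth p pq q0 by (subst ln_le_cancel_iff) auto
      also have "\<dots> = 4 * ln q" using q0 by (simp add: ln_realpow)
      finally show "ln (\<phi> q) \<le> 4 * ln q" .
      have "1 \<le> exp (1::real)" by simp
      then have "1 \<le> \<phi> q" using X \<phi>p \<phi>pq by linarith
      then show "0 \<le> ln (\<phi> q)" by simp
    qed
    finally have "1 + (\<phi> q - \<phi> p) \<le> ln q ^ m + C * (4 * ln q) ^ m"
      using one_le_power[OF l1, of m] by linarith
    also have "\<dots> = (1 + C * 4 ^ m) * ln q ^ m" by (simp add: power_mult_distrib algebra_simps)
    finally have *: "1 + (\<phi> q - \<phi> p) \<le> (1 + C * 4 ^ m) * ln q ^ m" .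
    have "q - p \<le> B * ln q ^ 3 * (1 + (\<phi> q - \<phi> p))" using gap p pq by blast
    also have "\<dots> \<le> B * ln q ^ 3 * ((1 + C * 4 ^ m) * ln q ^ m)"
      using * B l1 by (intro mult_left_mono) auto
    finally show "q - p \<le> (B * (1 + C * 4 ^ m)) * ln q ^ (m + 3)"
      by (simp add: power_add mult_ac)
  qed
  with B C show ?case
    by (intro exI[of _ "B * (1 + C * 4 ^ m)"] exI[of _ "m + 3"] conjI) auto
qed

section \<open>The quotient of two mean value formulas\<close>

text \<open>The logarithm of any point between \<open>p\<close> and \<open>q\<close> is squeezed
  between \<open>ln p\<close> and \<open>ln q\<close>, so \<omega> at both points is asymptotic to
  \<open>ln p\<close>.\<close>

lemma omega_ratio_tendsto_1:
  assumes p: "filterlim p at_top F" and ratio: "((\<lambda>L. ln (q L) / ln (p L)) \<longlongrightarrow> 1) F"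
    and x: "\<forall>\<^sub>F L in F. p L \<le> x L \<and> x L \<le> q L" and y: "\<forall>\<^sub>F L in F. p L \<le> y L \<and> y L \<le> q L"
  shows "((\<lambda>L. \<omega> (x L) / \<omega> (y L)) \<longlongrightarrow> 1) F"
proof -
  have xtop: "filterlim x at_top F" by (rule filterlim_at_top_mono[OF p]) (use x in \<open>auto elim: eventually_mono\<close>)
  have ytop: "filterlim y at_top F" by (rule filterlim_at_top_mono[OF p]) (use y in \<open>auto elim: eventually_mono\<close>)
  have p1: "\<forall>\<^sub>F L in F. 1 < p L" using p by (simp add: filterlim_at_top_dense)
  have lp: "((\<lambda>L. ln (z L) / ln (p L)) \<longlongrightarrow> 1) F" if z: "\<forall>\<^sub>F L in F. p L \<le> z L \<and> z L \<le> q L" for z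
  proof (rule tendsto_sandwich[OF _ _ tendsto_const[of 1] ratio])
    show "\<forall>\<^sub>F L in F. 1 \<le> ln (z L) / ln (p L)"
      using z p1 by eventually_elim (auto simp: le_divide_eq)
    show "\<forall>\<^sub>F L in F. ln (z L) / ln (p L) \<le> ln (q L) / ln (p L)"
      using z p1 by eventually_elim (auto intro!: divide_right_mono)
  qed
  have "((\<lambda>L. (\<omega> (x L) / ln (x L)) * (ln (x L) / ln (p L)) / ((\<omega> (y L) / ln (y L)) * (ln (y L) / ln (p L))))
      \<longlongrightarrow> 1 * 1 / (1 * 1)) F"
    by (intro tendsto_intros lp x y filterlim_compose[OF omega] xtop ytop) auto
  then have lim: "((\<lambda>L. (\<omega> (x L) / ln (x L)) * (ln (x L) / ln (p L)) / ((\<omega> (y L) / ln (y L)) * (ln (y L) / ln (p L))))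
      \<longlongrightarrow> 1) F" by simp
  show ?thesis
  proof (rule Lim_transform_eventually[OF lim])
    show "\<forall>\<^sub>F L in F. (\<omega> (x L) / ln (x L)) * (ln (x L) / ln (p L)) / ((\<omega> (y L) / ln (y L)) * (ln (y L) / ln (p L)))
        = \<omega> (x L) / \<omega> (y L)"
      using p1 x y
    proof eventually_elim
      case (elim L)
      then have "ln (x L) \<noteq> 0" "ln (y L) \<noteq> 0" "ln (p L) \<noteq> 0" by auto
      then show ?case by (simp add: field_simps)
    qed
  qed
qed

text \<open>The function may vary with \<open>L\<close>, as (t - 2 pi L)^\<Delta> does, while its
  integral \<open>I\<close> stays fixed. The length of the preimage interval cancels in the
  quotient, and the \<omega>-quotients left over form the product \<open>R\<close>, which tends to
  1.\<close>

lemma mean_value_zeta_product_tendsto: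
  fixes T :: "nat \<Rightarrow> real" and f :: "nat \<Rightarrow> real \<Rightarrow> real"
  assumes T: "filterlim T at_top sequentially" and U: "0 < U"
    and d: "\<forall>\<^sub>F L in sequentially. mean_value_point T0 \<phi> U (T L) k (f L) (d L)"
    and e: "\<forall>\<^sub>F L in sequentially. mean_value_point T0 \<phi> U (T L) k (\<lambda>_. 1) (e L)"
    and I: "\<forall>\<^sub>F L in sequentially. (f L has_integral I) {T L..T L + U}"
  shows "\<forall>\<^sub>F L in sequentially. assoc_point \<phi> k (d L) 0 \<in> {T L<..<T L + U}"
    and "(\<lambda>L. f L (assoc_point \<phi> k (d L) 0) * zeta_product \<phi> k (d L) (e L)) \<longlonglongrightarrow> I / U"
proof -
  define p where "p = (\<lambda>L. ladder_preimage T0 \<phi> k (T L))"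
  define q where "q = (\<lambda>L. ladder_preimage T0 \<phi> k (T L + U))"
  have TU: "filterlim (\<lambda>L. T L + U) at_top sequentially"
    by (rule filterlim_at_top_mono[OF T]) (use U in simp)
  have pq: "\<forall>\<^sub>F L in sequentially. (\<forall>j\<le>k. X \<le> (\<phi> ^^ j) (p L) \<and> X \<le> (\<phi> ^^ j) (q L)) \<and>
      (\<phi> ^^ k) (p L) = T L \<and> (\<phi> ^^ k) (q L) = T L + U" for X
    using eventually_compose_filterlim[OF eventually_ladder_preimage[of k X] T]
      eventually_compose_filterlim[OF eventually_ladder_preimage[of k X] TU]
    unfolding p_def q_def by eventually_elim blast
  \<comment> \<open>Strict monotonicity carries the inequalities p < x < q through the iterates.
    Hence the points belonging to \<open>d\<close> and \<open>e\<close> lie between the same ends at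
    each level, and for \<open>j = k\<close> the point lies strictly inside
    \<open>{T L..T L + U}\<close>.\<close>
  have orbits: "\<forall>\<^sub>F L in sequentially. \<forall>j\<le>k. (\<phi> ^^ j) (p L) < (\<phi> ^^ j) (x L) \<and> (\<phi> ^^ j) (x L) < (\<phi> ^^ j) (q L)"
    if x: "\<forall>\<^sub>F L in sequentially. x L \<in> {p L<..<q L}" for x
  proof -
    obtain X where X: "\<And>x y. X \<le> x \<Longrightarrow> x < y \<Longrightarrow> \<phi> x < \<phi> y"
      using eventually_strict_mono by (auto simp: eventually_at_top_linorder)
    show ?thesis using pq[of X] x
    proof eventually_elim
      case (elim L)
      show ?case
      proof (intro allI impI)
        fix j assume "j \<le> k"
        then show "(\<phi> ^^ j) (p L) < (\<phi> ^^ j) (x L) \<and> (\<phi> ^^ j) (x L) < (\<phi> ^^ j) (q L)"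
        proof (induction j)
          case 0
          then show ?case using elim by simp
        next
          case (Suc j)
          then have "X \<le> (\<phi> ^^ j) (p L)" using elim by simp
          with Suc show ?case by (auto intro!: X)
        qed
      qed
    qed
  qed
  have d_in: "\<forall>\<^sub>F L in sequentially. d L \<in> {p L<..<q L}"
    using d by eventually_elim (simp add: mean_value_point_def p_def q_def)
  have e_in: "\<forall>\<^sub>F L in sequentially. e L \<in> {p L<..<q L}"
    using e by eventually_elim (simp add: mean_value_point_def p_def q_def)
  show "\<forall>\<^sub>F L in sequentially. assoc_point \<phi> k (d L) 0 \<in> {T L<..<T L + U}"
    using orbits[OF d_in] pq[of 0] by eventually_elim (auto simp: assoc_point_def)

  have ratio: "(\<lambda>L. \<omega> ((\<phi> ^^ r) (d L)) / \<omega> ((\<phi> ^^ r) (e L))) \<longlonglongrightarrow> 1" if r: "r < k" for r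
  proof -
    let ?p = "\<lambda>L. (\<phi> ^^ r) (p L)" and ?q = "\<lambda>L. (\<phi> ^^ r) (q L)"
    have shift: "(\<phi> ^^ j) ((\<phi> ^^ r) x) = (\<phi> ^^ (j + r)) x" for j x by (simp add: funpow_add)
    have top: "filterlim ?p at_top sequentially"
      unfolding filterlim_at_top
    proof
      fix X show "\<forall>\<^sub>F L in sequentially. X \<le> ?p L"
        using pq[of X] by eventually_elim (use r in auto)
    qed
    have le: "\<forall>\<^sub>F L in sequentially. ?p L \<le> ?q L"
      using orbits[OF d_in] by eventually_elim (meson r less_imp_le less_trans)
    \<comment> \<open>The remaining \<open>k - r\<close> iterates carry the two ends to
      \<open>T L\<close> and \<open>T L + U\<close>, whose distance is exactly
      \<open>U\<close>.\<close>
    obtain C m where "\<forall>\<^sub>F X in at_top. \<forall>p q. (\<forall>j\<le>k - r. X \<le> (\<phi> ^^ j) p) \<longrightarrow> p \<le> q \<longrightarrow>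
     (\<phi> ^^ (k - r)) q - (\<phi> ^^ (k - r)) p \<le> U \<longrightarrow> q - p \<le> C * ln q ^ m"
      using iterated_gap_bound[of "k - r" U] by blast
    then obtain X where X: "\<And>p q. (\<forall>j\<le>k - r. X \<le> (\<phi> ^^ j) p) \<Longrightarrow> p \<le> q \<Longrightarrow>
     (\<phi> ^^ (k - r)) q - (\<phi> ^^ (k - r)) p \<le> U \<Longrightarrow> q - p \<le> C * ln q ^ m"
      by (auto dest!: eventually_happens)
    have "\<forall>\<^sub>F L in sequentially. ?q L - ?p L \<le> C * ln (?q L) ^ m"
      using pq[of X] le
    proof eventually_elim
      case (elim L)
      show ?case by (rule X) (use elim r in \<open>auto simp: shift\<close>)
    qed
    from ln_ratio_tendsto_1[OF le this top]
    have "(\<lambda>L. ln (?q L) / ln (?p L)) \<longlonglongrightarrow> 1" .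
    then show ?thesis
    proof (rule omega_ratio_tendsto_1[OF top])
      show "\<forall>\<^sub>F L in sequentially. ?p L \<le> (\<phi> ^^ r) (d L) \<and> (\<phi> ^^ r) (d L) \<le> ?q L"
        using orbits[OF d_in] by eventually_elim (meson r less_imp_le)
      show "\<forall>\<^sub>F L in sequentially. ?p L \<le> (\<phi> ^^ r) (e L) \<and> (\<phi> ^^ r) (e L) \<le> ?q L"
        using orbits[OF e_in] by eventually_elim (meson r less_imp_le)
    qed
  qed
  define R where "R = (\<lambda>L. \<Prod>r<k. \<omega> ((\<phi> ^^ r) (d L)) / \<omega> ((\<phi> ^^ r) (e L)))"
  have "R \<longlonglongrightarrow> (\<Prod>r<k. 1)" unfolding R_def by (intro tendsto_prod ratio) auto
  then have lim: "(\<lambda>L. I / U * R L) \<longlonglongrightarrow> I / U" using tendsto_mult_left[of R 1 sequentially "I / U"] by simp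

  have "\<forall>\<^sub>F X in at_top. \<forall>t\<ge>X. (1 \<le> \<omega> t \<and> \<omega> t \<le> 2 * ln t) \<and>
     (\<phi> has_real_derivative (cmod (zeta (Complex (1/2) t)))\<^sup>2 / \<omega> t) (at t)"
    by (intro eventually_all_ge_at_top eventually_conj eventually_omega_bounds deriv)
  then obtain X where X': "\<And>t. X \<le> t \<Longrightarrow> 1 \<le> \<omega> t"
    "\<And>t. X \<le> t \<Longrightarrow> (\<phi> has_real_derivative (cmod (zeta (Complex (1/2) t)))\<^sup>2 / \<omega> t) (at t)"
    by (auto dest!: eventually_happens)
  have X: "\<omega> t \<noteq> 0" "deriv \<phi> t = (cmod (zeta (Complex (1/2) t)))\<^sup>2 / \<omega> t" if "X \<le> t" for t
    using X'[OF that] by (auto intro: DERIV_imp_deriv)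
  show "(\<lambda>L. f L (assoc_point \<phi> k (d L) 0) * zeta_product \<phi> k (d L) (e L)) \<longlonglongrightarrow> I / U"
  proof (rule Lim_transform_eventually[OF lim])
    show "\<forall>\<^sub>F L in sequentially. I / U * R L = f L (assoc_point \<phi> k (d L) 0) * zeta_product \<phi> k (d L) (e L)"
      using pq[of X] orbits[OF d_in] orbits[OF e_in] d e I
    proof eventually_elim
      case (elim L)
      let ?z = "\<lambda>t. (cmod (zeta (Complex (1/2) t)))\<^sup>2"
      define D where "D = (\<Prod>r<k. deriv \<phi> ((\<phi> ^^ r) (d L)))"
      define E where "E = (\<Prod>r<k. deriv \<phi> ((\<phi> ^^ r) (e L)))"
      have d_ge: "X \<le> (\<phi> ^^ r) (d L)" and e_ge: "X \<le> (\<phi> ^^ r) (e L)" if "r < k" for r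
        using elim that by (meson less_imp_le order_trans)+
      have "I = f L ((\<phi> ^^ k) (d L)) * D * (q L - p L)"
        using elim by (auto simp: mean_value_point_def D_def p_def q_def dest: integral_unique)
      moreover have "U = E * (q L - p L)"
        using elim U by (auto simp: mean_value_point_def E_def p_def q_def)
      \<comment> \<open>Since \<open>U\<close> is positive, no derivative at the iterates of
        \<open>e L\<close> vanishes; so zeta is nonzero there and the quotients by its values are
        genuine.\<close>
      moreover from this have "E \<noteq> 0" "q L - p L \<noteq> 0" using U by auto
      ultimately have IU: "I / U = f L ((\<phi> ^^ k) (d L)) * (D / E)" by simp
      \<comment> \<open>The factor with index \<open>r\<close> in \<open>{1..k}\<close> uses the
        iterate of order \<open>k - r\<close>. Reversing the order gives the orders 0 to k - 1, as
        in the mean value formula.\<close>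
      have "zeta_product \<phi> k (d L) (e L) =
          (\<Prod>r<k. ?z ((\<phi> ^^ (k - Suc r)) (d L)) / ?z ((\<phi> ^^ (k - Suc r)) (e L)))"
        by (simp add: zeta_product_def assoc_point_def prod.atLeast1_atMost_eq norm_divide power_divide)
      also have "\<dots> = (\<Prod>r<k. ?z ((\<phi> ^^ r) (d L)) / ?z ((\<phi> ^^ r) (e L)))"
        by (rule prod.nat_diff_reindex)
      also have "\<dots> = (\<Prod>r<k. deriv \<phi> ((\<phi> ^^ r) (d L)) / deriv \<phi> ((\<phi> ^^ r) (e L)) *
          (\<omega> ((\<phi> ^^ r) (d L)) / \<omega> ((\<phi> ^^ r) (e L))))"
        using X d_ge e_ge by (intro prod.cong) simp_all
      also have "\<dots> = D / E * R L"
        by (simp add: prod.distrib prod_dividef D_def E_def R_def)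
      finally show ?case using IU by (simp add: assoc_point_def)
    qed
  qed
qed

end

section \<open>Trigonometric averages\<close>

text \<open>With S = sin U, the average of cos^3 over [0, U] is S/U - S^3/(3U), and S/U is the
  average of cos. The second term is (U^2/3)(S/U)^3. Here (S/U)^2 is the product of the average S/(U
  cos U) of 1/cos^2 and the average S cos(U)/U of cos^2 - sin^2, which explains the powers 3/2. The
  average of t^\<Delta> is U^\<Delta>/(1 + \<Delta>), so the power 2/\<Delta> together with (1 +
  \<Delta>)^(2/\<Delta>) supplies U^2.\<close>

theorem mainTheorem4:
  fixes \<mu> \<phi>1 \<omega> :: "real \<Rightarrow> real" and y0 T0 \<epsilon> U \<Delta> :: real
    and k0 k3 k4 k5 k6 k7 k\<Delta> :: nat
    and d :: "real \<Rightarrow> real \<Rightarrow> nat \<Rightarrow> (real \<Rightarrow> real) \<Rightarrow> real"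
    and e :: "real \<Rightarrow> real \<Rightarrow> nat \<Rightarrow> real"
    and f3 f4 f5 f6 f7 :: "real \<Rightarrow> real" and f\<Delta> :: "nat \<Rightarrow> real \<Rightarrow> real"
    and \<alpha>0 P :: "nat \<Rightarrow> (real \<Rightarrow> real) \<Rightarrow> nat \<Rightarrow> real"
  assumes y0: "0 < y0"
    and \<mu>_smooth: "smooth_from y0 \<mu>"
    and \<mu>_mono: "mono_on {y0..} \<mu>"
    and \<mu>_unbounded: "\<not> bdd_above (\<mu> ` {y0..})"
    and \<mu>_ge: "\<And>y. y0 \<le> y \<Longrightarrow> 7 * y * ln y \<le> \<mu> y"
    and T0: "0 < T0"
    and unique_solution: "\<And>T. T0 \<le> T \<Longrightarrow> \<exists>!x. jacob_solution \<mu> y0 T x"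
    and \<phi>1: "\<phi>1 = jacobs_ladder \<mu> y0"
    and \<phi>1_deriv: "\<forall>\<^sub>F t in at_top.
          (\<phi>1 has_real_derivative (cmod (zeta (Complex (1/2) t)))\<^sup>2 / \<omega> t) (at t)"
    and \<omega>: "(\<lambda>t. \<omega> t / ln t - 1) \<in> O[at_top](\<lambda>t. ln (ln t) / ln t)"
    and k0: "1 \<le> k0"
    and \<epsilon>: "0 < \<epsilon>" "\<epsilon> < pi / 2"
    and U: "0 < U" "U \<le> pi / 2 - \<epsilon>"
    and \<Delta>: "0 < \<Delta>"
    and ks: "k3 \<in> {1..k0}" "k4 \<in> {1..k0}" "k5 \<in> {1..k0}" "k6 \<in> {1..k0}" "k7 \<in> {1..k0}"
      "k\<Delta> \<in> {1..k0}"
    and d: "\<And>k. k \<in> {1..k0} \<Longrightarrow>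
          \<forall>\<^sub>F T in at_top. \<forall>f\<in>C0_class T U. mean_value_point T0 \<phi>1 U T k f (d U T k f)"
    and e: "\<And>k. k \<in> {1..k0} \<Longrightarrow>
          \<forall>\<^sub>F T in at_top. mean_value_point T0 \<phi>1 U T k (\<lambda>_. 1) (e U T k)"
    and f3: "f3 = (\<lambda>t. (sin t)\<^sup>2)"
    and f4: "f4 = (\<lambda>t. (cos t)\<^sup>2)"
    and f5: "f5 = (\<lambda>t. 1 / (cos t)\<^sup>2)"
    and f6: "f6 = (\<lambda>t. (cos t) ^ 3)"
    and f7: "f7 = (\<lambda>t. cos t)"
    and f\<Delta>: "f\<Delta> = (\<lambda>L t. (t - 2 * pi * real L) powr \<Delta>)"
    and \<alpha>0: "\<And>k f L. \<alpha>0 k f L = assoc_point \<phi>1 k (d U (2 * pi * real L) k f) 0"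
    and P: "\<And>k f L. P k f L =
          zeta_product \<phi>1 k (d U (2 * pi * real L) k f) (e U (2 * pi * real L) k)"
  shows "(\<lambda>L. P k6 f6 L /
      (cos (\<alpha>0 k7 f7 L) / (cos (\<alpha>0 k6 f6 L)) ^ 3 * P k7 f7 L
       - (1 + \<Delta>) powr (2 / \<Delta>) / 3
         * ((\<alpha>0 k\<Delta> (f\<Delta> L) L - 2 * pi * real L)\<^sup>2
             / ((cos (\<alpha>0 k5 f5 L)) ^ 3 * (cos (\<alpha>0 k6 f6 L)) ^ 3))
         * P k\<Delta> (f\<Delta> L) L powr (2 / \<Delta>)
         * P k5 f5 L powr (3 / 2)
         * ((cos (\<alpha>0 k4 f4 L))\<^sup>2 * P k4 f4 L
             - (sin (\<alpha>0 k3 f3 L))\<^sup>2 * P k3 f3 L) powr (3 / 2)))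
    \<longlonglongrightarrow> 1"
proof -
  let ?T = "\<lambda>L. 2 * pi * real L"
  have T: "filterlim ?T at_top sequentially" by real_asymp
  \<comment> \<open>The strict inequality keeps the cosine positive on the closed interval [0, U],
    where 1/cos^2 is therefore continuous.\<close>
  have U_lt: "U < pi / 2" using U(2) \<epsilon>(1) by simp
  have omega: "((\<lambda>t. \<omega> t / ln t) \<longlongrightarrow> 1) at_top"
  proof -
    have "(\<lambda>t::real. ln (ln t) / ln t) \<in> o[at_top](\<lambda>_. 1)" by real_asymp
    then have "(\<lambda>t. \<omega> t / ln t - 1) \<in> o[at_top](\<lambda>_. 1)" by (rule landau_o.big_small_trans[OF \<omega>])
    then have "((\<lambda>t. \<omega> t / ln t - 1) \<longlongrightarrow> 0) at_top" by (auto dest: smalloD_tendsto)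
    then show ?thesis by (simp add: LIM_zero_iff)
  qed
  interpret ladder \<phi>1 \<omega> T0
    using inj_on_jacobs_ladder[OF less_imp_le[OF T0] unique_solution] \<phi>1_deriv omega
    by unfold_locales (simp_all add: \<phi>1)

  \<comment> \<open>Translation by 2 pi L reduces everything to a fixed \<open>g\<close> on [0, U].
    The right end certifies that \<open>g\<close> is not identically zero, because sin^2 and
    t^\<Delta> vanish at the left end.\<close>
  have limits: "(\<forall>\<^sub>F L in sequentially. \<alpha>0 k (f L) L - ?T L \<in> {0<..<U}) \<and>
      (\<lambda>L. f L (\<alpha>0 k (f L) L) * P k (f L) L) \<longlonglongrightarrow> I / U"
    if k: "k \<in> {1..k0}" and f: "\<And>L. f L = (\<lambda>t. g (t - ?T L))"
      and cont: "continuous_on {0..U} g" and nonneg: "\<And>t. t \<in> {0..U} \<Longrightarrow> 0 \<le> g t"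
      and nonzero: "g U \<noteq> 0" and int: "(g has_integral I) {0..U}"
    for k I and f :: "nat \<Rightarrow> real \<Rightarrow> real" and g
  proof -
    have C0: "f L \<in> C0_class (?T L) U" for L
    proof -
      have "continuous_on {?T L..?T L + U} (f L)"
        unfolding f by (rule continuous_on_compose2[OF cont]) (auto intro!: continuous_intros)
      moreover have "\<forall>t\<in>{?T L..?T L + U}. 0 \<le> f L t" unfolding f by (auto intro!: nonneg)
      moreover have "f L (?T L + U) \<noteq> 0" unfolding f using nonzero by simp
      ultimately show ?thesis using U(1) by (auto simp: C0_class_def intro!: bexI[of _ "?T L + U"])
    qed
    have dL: "\<forall>\<^sub>F L in sequentially. mean_value_point T0 \<phi>1 U (?T L) k (f L) (d U (?T L) k (f L))"
      using eventually_compose_filterlim[OF d[OF k] T] by eventually_elim (use C0 in blast)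
    have eL: "\<forall>\<^sub>F L in sequentially. mean_value_point T0 \<phi>1 U (?T L) k (\<lambda>_. 1) (e U (?T L) k)"
      by (rule eventually_compose_filterlim[OF e[OF k] T])
    have iL: "(f L has_integral I) {?T L..?T L + U}" for L
      using has_integral_affinity[of g I 0 U 1 "- ?T L"] int
      by (simp add: f cbox_interval add.commute[of U])
    note * = mean_value_zeta_product_tendsto[OF T U(1) dL eL always_eventually[OF allI[OF iL]]]
    show ?thesis
      using *(2) eventually_mono[OF *(1), of "\<lambda>L. \<alpha>0 k (f L) L - ?T L \<in> {0<..<U}"]
      by (simp add: \<alpha>0 P)
  qed
  have periodic: "sin (t - ?T L) = sin t" "cos (t - ?T L) = cos t" for t L
    using sin_2npi[of L] cos_2npi[of L] by (simp_all add: sin_diff cos_diff mult_ac)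
  have cos_pos: "0 < cos t" if "t \<in> {0..U}" for t
    using that U_lt by (intro cos_gt_zero_pi) auto
  have sinU: "0 < sin U" using U(1) U_lt by (intro sin_gt_zero) auto
  have cosU: "0 < cos U" using cos_pos U(1) by simp

  \<comment> \<open>The averages of the six functions over [0, U]\<close>
  have lim3: "(\<lambda>L. (sin (\<alpha>0 k3 f3 L))\<^sup>2 * P k3 f3 L) \<longlonglongrightarrow> ((U - sin U * cos U) / 2) / U"
  proof -
    have "((\<lambda>t. (sin t)\<^sup>2) has_integral ((U - sin U * cos U) / 2 - (0 - sin 0 * cos 0) / 2)) {0..U}"
      by (rule fundamental_theorem_of_calculus)
         (use U in \<open>auto intro!: derivative_eq_intros simp: has_real_derivative_iff_has_vector_derivative[symmetric]
            sin_squared_eq power2_eq_square[symmetric] field_simps\<close>)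
    moreover have "continuous_on {0..U} (\<lambda>t. (sin t)\<^sup>2)" by (intro continuous_intros)
    ultimately show ?thesis
      using limits[OF ks(1), of "\<lambda>_. f3" "\<lambda>t. (sin t)\<^sup>2" "(U - sin U * cos U) / 2"] sinU
      by (auto simp: f3 periodic)
  qed
  have lim4: "(\<lambda>L. (cos (\<alpha>0 k4 f4 L))\<^sup>2 * P k4 f4 L) \<longlonglongrightarrow> ((U + sin U * cos U) / 2) / U"
  proof -
    have "((\<lambda>t. (cos t)\<^sup>2) has_integral ((U + sin U * cos U) / 2 - (0 + sin 0 * cos 0) / 2)) {0..U}"
      by (rule fundamental_theorem_of_calculus)
         (use U in \<open>auto intro!: derivative_eq_intros simp: has_real_derivative_iff_has_vector_derivative[symmetric]
            cos_squared_eq power2_eq_square[symmetric] field_simps\<close>)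
    moreover have "continuous_on {0..U} (\<lambda>t. (cos t)\<^sup>2)" by (intro continuous_intros)
    ultimately show ?thesis
      using limits[OF ks(2), of "\<lambda>_. f4" "\<lambda>t. (cos t)\<^sup>2" "(U + sin U * cos U) / 2"] cosU
      by (auto simp: f4 periodic)
  qed
  have lim5: "(\<lambda>L. 1 / (cos (\<alpha>0 k5 f5 L))\<^sup>2 * P k5 f5 L) \<longlonglongrightarrow> (sin U / cos U) / U"
    and loc5: "\<forall>\<^sub>F L in sequentially. \<alpha>0 k5 f5 L - ?T L \<in> {0<..<U}"
  proof -
    have "((\<lambda>t. 1 / (cos t)\<^sup>2) has_integral (tan U - tan 0)) {0..U}"
      by (rule fundamental_theorem_of_calculus)
         (use U cos_pos in \<open>force intro!: derivative_eq_intros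
            simp: has_real_derivative_iff_has_vector_derivative[symmetric] inverse_eq_divide\<close>)+
    moreover have "continuous_on {0..U} (\<lambda>t. 1 / (cos t)\<^sup>2)"
      using cos_pos by (force intro!: continuous_intros)
    ultimately show "(\<lambda>L. 1 / (cos (\<alpha>0 k5 f5 L))\<^sup>2 * P k5 f5 L) \<longlonglongrightarrow> (sin U / cos U) / U"
      "\<forall>\<^sub>F L in sequentially. \<alpha>0 k5 f5 L - ?T L \<in> {0<..<U}"
      using limits[OF ks(3), of "\<lambda>_. f5" "\<lambda>t. 1 / (cos t)\<^sup>2" "sin U / cos U"] cosU
      by (auto simp: f5 periodic tan_def)
  qed
  define I6 where "I6 = (sin U - sin U ^ 3 / 3) / U"
  have lim6: "(\<lambda>L. cos (\<alpha>0 k6 f6 L) ^ 3 * P k6 f6 L) \<longlonglongrightarrow> I6"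
    and loc6: "\<forall>\<^sub>F L in sequentially. \<alpha>0 k6 f6 L - ?T L \<in> {0<..<U}"
  proof -
    have "((\<lambda>t. cos t ^ 3) has_integral ((sin U - sin U ^ 3 / 3) - (sin 0 - sin 0 ^ 3 / 3))) {0..U}"
    proof (rule fundamental_theorem_of_calculus)
      fix t assume "t \<in> {0..U}"
      have "cos t ^ 3 = cos t * (cos t)\<^sup>2" by (simp add: power2_eq_square power3_eq_cube)
      then have "cos t - cos t * (sin t)\<^sup>2 = cos t ^ 3"
        by (simp add: cos_squared_eq right_diff_distrib mult.commute)
      then show "((\<lambda>t. sin t - sin t ^ 3 / 3) has_vector_derivative cos t ^ 3) (at t within {0..U})"
        by (auto intro!: derivative_eq_intros simp: has_real_derivative_iff_has_vector_derivative[symmetric])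
    qed (use U in simp)
    moreover have "continuous_on {0..U} (\<lambda>t. cos t ^ 3)" by (intro continuous_intros)
    moreover have "0 \<le> cos t ^ 3" if "t \<in> {0..U}" for t using cos_pos[OF that] by simp
    ultimately show "(\<lambda>L. cos (\<alpha>0 k6 f6 L) ^ 3 * P k6 f6 L) \<longlonglongrightarrow> I6"
      "\<forall>\<^sub>F L in sequentially. \<alpha>0 k6 f6 L - ?T L \<in> {0<..<U}"
      using limits[OF ks(4), of "\<lambda>_. f6" "\<lambda>t. cos t ^ 3" "sin U - sin U ^ 3 / 3"] cosU
      by (auto simp: f6 periodic I6_def)
  qed
  have lim7: "(\<lambda>L. cos (\<alpha>0 k7 f7 L) * P k7 f7 L) \<longlonglongrightarrow> sin U / U"
  proof -
    have "((\<lambda>t. cos t) has_integral (sin U - sin 0)) {0..U}"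
      by (rule fundamental_theorem_of_calculus)
         (use U in \<open>auto intro!: derivative_eq_intros simp: has_real_derivative_iff_has_vector_derivative[symmetric]\<close>)
    moreover have "continuous_on {0..U} (\<lambda>t. cos t)" by (intro continuous_intros)
    ultimately show ?thesis
      using limits[OF ks(5), of "\<lambda>_. f7" "\<lambda>t. cos t" "sin U"] cosU less_imp_le[OF cos_pos]
      by (auto simp: f7 periodic)
  qed
  have lim\<Delta>: "(\<lambda>L. (\<alpha>0 k\<Delta> (f\<Delta> L) L - ?T L) powr \<Delta> * P k\<Delta> (f\<Delta> L) L) \<longlonglongrightarrow> (U powr (\<Delta> + 1) / (\<Delta> + 1)) / U"
    and loc\<Delta>: "\<forall>\<^sub>F L in sequentially. \<alpha>0 k\<Delta> (f\<Delta> L) L - ?T L \<in> {0<..<U}"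
  proof -
    have "((\<lambda>t. t powr \<Delta>) has_integral (U powr (\<Delta> + 1) / (\<Delta> + 1))) {0..U}"
      by (rule has_integral_powr_from_0) (use \<Delta> U in auto)
    moreover have "continuous_on {0..U} (\<lambda>t. t powr \<Delta>)"
      using \<Delta> by (intro continuous_on_powr') (auto intro!: continuous_intros)
    ultimately show "(\<lambda>L. (\<alpha>0 k\<Delta> (f\<Delta> L) L - ?T L) powr \<Delta> * P k\<Delta> (f\<Delta> L) L) \<longlonglongrightarrow> (U powr (\<Delta> + 1) / (\<Delta> + 1)) / U"
      "\<forall>\<^sub>F L in sequentially. \<alpha>0 k\<Delta> (f\<Delta> L) L - ?T L \<in> {0<..<U}"
      using limits[OF ks(6), of f\<Delta> "\<lambda>t. t powr \<Delta>" "U powr (\<Delta> + 1) / (\<Delta> + 1)"] U by (auto simp: f\<Delta>)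
  qed

  \<comment> \<open>The identity between the averages\<close>
  have I6_pos: "0 < I6"
  proof -
    have "sin U ^ 3 \<le> sin U" using power_decreasing[of 1 3 "sin U"] sinU by simp
    then show ?thesis using sinU U(1) by (simp add: I6_def)
  qed
  have P_nonneg: "0 \<le> P k f L" for k f L
    unfolding P zeta_product_def by (intro prod_nonneg) simp

  let ?A = "\<lambda>L. cos (\<alpha>0 k7 f7 L) * P k7 f7 L"
  let ?B = "\<lambda>L. (\<alpha>0 k\<Delta> (f\<Delta> L) L - ?T L) powr \<Delta> * P k\<Delta> (f\<Delta> L) L"
  let ?C = "\<lambda>L. 1 / (cos (\<alpha>0 k5 f5 L))\<^sup>2 * P k5 f5 L"
  let ?D = "\<lambda>L. (cos (\<alpha>0 k4 f4 L))\<^sup>2 * P k4 f4 L - (sin (\<alpha>0 k3 f3 L))\<^sup>2 * P k3 f3 L"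
  let ?N = "\<lambda>L. cos (\<alpha>0 k6 f6 L) ^ 3 * P k6 f6 L"
  \<comment> \<open>\<open>M\<close> is the right-hand side of the claim multiplied by the cube of
    the cosine at the point for \<open>f6\<close>. The square of the shifted point and the cosine
    for \<open>f5\<close> have been drawn into the real powers, so that each base is one of the
    averages just computed.\<close>
  define M where "M = (\<lambda>L. ?A L - (1 + \<Delta>) powr (2 / \<Delta>) / 3 * ?B L powr (2 / \<Delta>) * ?C L powr (3/2) * ?D L powr (3/2))"
  have M: "M \<longlonglongrightarrow> I6"
  proof -
    have "?D \<longlonglongrightarrow> ((U + sin U * cos U) / 2) / U - ((U - sin U * cos U) / 2) / U"
      by (intro tendsto_diff lim3 lim4)
    moreover have "((U + sin U * cos U) / 2) / U - ((U - sin U * cos U) / 2) / U = sin U * cos U / U"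
      using U by (simp add: field_simps)
    ultimately have D: "?D \<longlonglongrightarrow> sin U * cos U / U" by simp
    have "M \<longlonglongrightarrow> sin U / U - (1 + \<Delta>) powr (2 / \<Delta>) / 3 * ((U powr (\<Delta> + 1) / (\<Delta> + 1)) / U) powr (2 / \<Delta>) *
        ((sin U / cos U) / U) powr (3/2) * (sin U * cos U / U) powr (3/2)"
      unfolding M_def
      by (intro tendsto_diff tendsto_mult tendsto_powr tendsto_const lim5 lim7 lim\<Delta> D)
         (use sinU cosU U \<Delta> in auto)
    also have "((U powr (\<Delta> + 1) / (\<Delta> + 1)) / U) powr (2 / \<Delta>) = U\<^sup>2 / (1 + \<Delta>) powr (2 / \<Delta>)"
    proof -
      have "(U powr (\<Delta> + 1) / (\<Delta> + 1)) / U = U powr \<Delta> / (1 + \<Delta>)"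
        using U by (simp add: powr_add add.commute)
      then show ?thesis using U \<Delta> by (simp add: powr_divide powr_powr powr_numeral)
    qed
    also have "sin U / U - (1 + \<Delta>) powr (2 / \<Delta>) / 3 * (U\<^sup>2 / (1 + \<Delta>) powr (2 / \<Delta>)) *
        ((sin U / cos U) / U) powr (3/2) * (sin U * cos U / U) powr (3/2) = I6"
    proof -
      have "((sin U / cos U) / U) powr (3/2) * (sin U * cos U / U) powr (3/2) =
          ((sin U / U)\<^sup>2) powr (3/2)"
        using sinU cosU U by (subst powr_mult[symmetric]) (auto simp: power2_eq_square)
      also have "\<dots> = (sin U / U) ^ 3"
        using sinU U by (simp add: powr_powr flip: powr_numeral)
      finally have "((sin U / cos U) / U) powr (3/2) * (sin U * cos U / U) powr (3/2) = (sin U / U) ^ 3" .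
      then have "sin U / U - (1 + \<Delta>) powr (2 / \<Delta>) / 3 * (U\<^sup>2 / (1 + \<Delta>) powr (2 / \<Delta>)) *
        ((sin U / cos U) / U) powr (3/2) * (sin U * cos U / U) powr (3/2) =
        sin U / U - (1 + \<Delta>) powr (2 / \<Delta>) / 3 * (U\<^sup>2 / (1 + \<Delta>) powr (2 / \<Delta>)) * (sin U / U) ^ 3"
        by (simp only: mult.assoc)
      also have "\<dots> = I6" using \<Delta> U unfolding I6_def
        by (simp add: field_simps power2_eq_square power3_eq_cube)
      finally show ?thesis .
    qed
    finally show ?thesis .
  qed
  have lim: "(\<lambda>L. ?N L / M L) \<longlonglongrightarrow> 1"
    using tendsto_divide[OF lim6 M] I6_pos by simp
  show ?thesis
  proof (rule Lim_transform_eventually[OF lim])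
    show "\<forall>\<^sub>F L in sequentially. ?N L / M L = P k6 f6 L /
      (cos (\<alpha>0 k7 f7 L) / (cos (\<alpha>0 k6 f6 L)) ^ 3 * P k7 f7 L
       - (1 + \<Delta>) powr (2 / \<Delta>) / 3
         * ((\<alpha>0 k\<Delta> (f\<Delta> L) L - 2 * pi * real L)\<^sup>2
             / ((cos (\<alpha>0 k5 f5 L)) ^ 3 * (cos (\<alpha>0 k6 f6 L)) ^ 3))
         * P k\<Delta> (f\<Delta> L) L powr (2 / \<Delta>)
         * P k5 f5 L powr (3 / 2)
         * ((cos (\<alpha>0 k4 f4 L))\<^sup>2 * P k4 f4 L
             - (sin (\<alpha>0 k3 f3 L))\<^sup>2 * P k3 f3 L) powr (3 / 2))"
      using loc5 loc6 loc\<Delta>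
    proof eventually_elim
      case (elim L)
      \<comment> \<open>The locations of the three points make \<open>a\<close>, \<open>c5\<close>
        and \<open>c6\<close> positive, as needed to split the real powers and to cancel the cube of
        \<open>c6\<close>.\<close>
      define a where "a = \<alpha>0 k\<Delta> (f\<Delta> L) L - ?T L"
      define c5 where "c5 = cos (\<alpha>0 k5 f5 L)"
      define c6 where "c6 = cos (\<alpha>0 k6 f6 L)"
      have a: "0 < a" using elim by (simp add: a_def)
      have c5: "0 < c5" and c6: "0 < c6"
        using cos_pos[of "\<alpha>0 k5 f5 L - ?T L"] cos_pos[of "\<alpha>0 k6 f6 L - ?T L"] elim
        by (auto simp: periodic c5_def c6_def)
      have B: "(a powr \<Delta> * P k\<Delta> (f\<Delta> L) L) powr (2 / \<Delta>) = a\<^sup>2 * P k\<Delta> (f\<Delta> L) L powr (2 / \<Delta>)"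
        using a \<Delta> P_nonneg by (simp add: powr_mult powr_powr powr_numeral)
      have "(1 / c5\<^sup>2) powr (3/2) = 1 / c5 ^ 3"
        using c5 by (simp add: powr_divide powr_powr flip: powr_numeral)
      then have C: "(1 / c5\<^sup>2 * P k5 f5 L) powr (3/2) = 1 / c5 ^ 3 * P k5 f5 L powr (3/2)"
        by (subst powr_mult) (use P_nonneg in simp_all)
      show ?case
        unfolding M_def c5_def[symmetric] c6_def[symmetric] a_def[symmetric] B C
        using c5 c6 by (simp add: field_simps)
    qed
  qed
qed

end
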